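(* With the notation in the context, the linear map $(q^2-1)D_3(x_0)+D_4(x_0)$ is invertible, and there exists a unique $\mathfrak{W}_q$-module structure on $\mathbb C^{\mathcal L(\Omega)}$ in which $E_1=q^{\dim x_0-D}L_1(x_0)$, $E_2=q^{\dim x_0-D}D_1(x_0)L_2(x_0)$, $F_1=q^{1-\dim x_0}R_1(x_0)D_2(x_0)^{-1}$, $F_2=q^{1-\dim x_0}R_2(x_0)$, $K_1^{\pm1}=D_1(x_0)^{\pm1}$, $K_2^{\pm1}=D_2(x_0)^{\pm1}$, and $I^{\pm1}=q^{\mp D}D_1(x_0)^{\pm1}D_2(x_0)^{\mp1}\big((q^2-1)D_3(x_0)+D_4(x_0)\big)^{\pm1}$.
   Context: $\Omega$ is a $D$-dimensional vector space over a finite field $\mathbb F$ and $q=\sqrt{|\mathbb F|}$ (so $q$ is not a root of unity). $[x,y]=xy-yx$, $[x,y]_q=qxy-q^{-1}yx$. $\mathfrak{W}_q$ is the algebra over $\mathbb C$ generated by $E_1,E_2,F_1,F_2,K_1^{\pm1},K_2^{\pm1},I^{\pm1}$ subject to: $I$ is central; $II^{-1}=I^{-1}I=1$, $K_1K_1^{-1}=K_1^{-1}K_1=1$, $K_2K_2^{-1}=K_2^{-1}K_2=1$; $[K_1,E_2]=[K_1,F_2]=[K_1,K_2]=[K_2,E_1]=[K_2,F_1]=0$; $[E_1,K_1]_q=[K_1,F_1]_q=[E_2,K_2]_q=[K_2,F_2]_q=0$; $[E_1,E_2]=[E_1,F_2]=[F_1,E_2]=[F_1,F_2]=0$; $[E_1,F_1]=\frac{K_1-IK_1^{-1}}{q-q^{-1}}$;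 $[E_2,F_2]=\frac{IK_2-K_2^{-1}}{q-q^{-1}}$. $\mathcal L(\Omega)$ is the set of subspaces of $\Omega$ and $\mathbb C^{\mathcal L(\Omega)}$ the complex vector space with basis $\mathcal L(\Omega)$; $x'\subset\mathrel{\cdot} x$ means $x'\subseteq x$ with $\dim x'=\dim x-1$; $|y|$ is the cardinality of a subspace $y$. Fix subspaces $x_0,x_1$ with $\Omega=x_0\oplus x_1$; for $u\in\Omega$ write $u=u_0+u_1$ with $u_0\in x_0,u_1\in x_1$. For $x\in\mathcal L(\Omega)$ let $\tau(x):(x+x_0)/x_0\to x_0/(x\cap x_0)$ be $u+x_0\mapsto u_0+(x\cap x_0)$ ($u\in x$). Linear maps on $\mathbb C^{\mathcal L(\Omega)}$: $L_1(x_0)x=\sum x'$ over $x'\subset\mathrel{\cdot} x$ with $x'\cap x_0=x\cap x_0$; $L_2(x_0)x=\sum x'$ over $x'\subset\mathrel{\cdot} x$ with $x'+x_0=x+x_0$; $R_1(x_0)x=\sum x'$ over $x\subset\mathrel{\cdot} x'$ with $x'\cap x_0=x\cap x_0$; $R_2(x_0)x=\sum x'$ over $x\subset\mathrel{\cdot} x'$ with $x'+x_0=x+x_0$; $D_1(x_0)x=q^{\dim(\Omega/x_0)-2\dim((x+x_0)/x_0)}x$; $D_2(x_0)x=q^{\dim x_0-2\dim(x\cap x_0)}x$; $D_3(x_0)x=\sum x'$ over $x'$ with $x'+x_0=x+x_0$, $x'\cap x_0=x\cap x_0$, $\operatorname{rank}(\tau(x')-\tau(x))=1$; $D_4(x_0)x=\big(\frac{|x|+|x_0|}{|x\cap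 x_0|}-1\big)x$. *)

theory Defs
  imports Complex_Main
begin

text \<open>Vector space: a scalar multiplication sc :: 'a \<Rightarrow> 'v \<Rightarrow> 'v over the (finite) field 'a,
  and Omega is a subspace of 'v (the ambient space of the paper).\<close>

definition ssum :: "'v::ab_group_add set \<Rightarrow> 'v set \<Rightarrow> 'v set" where
  "ssum A B = {a + b | a b. a \<in> A \<and> b \<in> B}"

definition subspaces :: "('a::field \<Rightarrow> 'v::ab_group_add \<Rightarrow> 'v) \<Rightarrow> 'v set \<Rightarrow> 'v set set" where
  "subspaces sc Om = {x. module.subspace sc x \<and> x \<subseteq> Om}"

abbreviation vdim :: "('a::field \<Rightarrow> 'v::ab_group_add \<Rightarrow> 'v) \<Rightarrow> 'v set \<Rightarrow> nat" where
  "vdim sc S \<equiv> vector_space.dim sc S"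

definition covby :: "('a::field \<Rightarrow> 'v::ab_group_add \<Rightarrow> 'v) \<Rightarrow> 'v set \<Rightarrow> 'v set \<Rightarrow> bool" where
  "covby sc y x \<longleftrightarrow> y \<subseteq> x \<and> vdim sc y + 1 = vdim sc x"

definition qq :: "'a::finite itself \<Rightarrow> complex" where
  "qq (t::'a itself) = complex_of_real (sqrt (real (card (UNIV :: 'a set))))"

definition proj0 :: "'v::ab_group_add set \<Rightarrow> 'v set \<Rightarrow> 'v \<Rightarrow> 'v" where
  "proj0 x0 x1 u = (THE u0. u0 \<in> x0 \<and> u - u0 \<in> x1)"

text \<open>rank(tau(y) - tau(x)) where tau(x) : (x+x0)/x0 \<rightarrow> x0/(x \<inter> x0), u + x0 \<mapsto> u_0 + (x \<inter> x0),
  for y with y + x0 = x + x0 and y \<inter> x0 = x \<inter> x0.  The image of tau(y) - tau(x) is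
  P/(x \<inter> x0) where P \<subseteq> x0 is the union of the image cosets; so the rank is dim P - dim (x \<inter> x0).\<close>
definition tau_img_preimage :: "'v::ab_group_add set \<Rightarrow> 'v set \<Rightarrow> 'v set \<Rightarrow> 'v set \<Rightarrow> 'v set" where
  "tau_img_preimage x0 x1 y x =
     {w. \<exists>u\<in>y. \<exists>v\<in>x. u - v \<in> x0 \<and> w - (proj0 x0 x1 u - proj0 x0 x1 v) \<in> x \<inter> x0}"

definition tau_rank_diff :: "('a::field \<Rightarrow> 'v::ab_group_add \<Rightarrow> 'v) \<Rightarrow> 'v set \<Rightarrow> 'v set \<Rightarrow> 'v set \<Rightarrow> 'v set \<Rightarrow> nat" where
  "tau_rank_diff sc x0 x1 y x = vdim sc (tau_img_preimage x0 x1 y x) - vdim sc (x \<inter> x0)"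

section \<open>Linear operators on C^{L(Omega)} as matrices: A y x = coefficient of y in A x\<close>

type_synonym 'v op = "'v set \<Rightarrow> 'v set \<Rightarrow> complex"

definition opmul :: "'v set set \<Rightarrow> 'v op \<Rightarrow> 'v op \<Rightarrow> 'v op" where
  "opmul L A B = (\<lambda>y x. \<Sum>z\<in>L. A y z * B z x)"

definition opid :: "'v op" where
  "opid = (\<lambda>y x. if y = x then 1 else 0)"

definition opzero :: "'v op" where
  "opzero = (\<lambda>y x. 0)"

definition opadd :: "'v op \<Rightarrow> 'v op \<Rightarrow> 'v op" where
  "opadd A B = (\<lambda>y x. A y x + B y x)"

definition opsmult :: "complex \<Rightarrow> 'v op \<Rightarrow> 'v op" where
  "opsmult c A = (\<lambda>y x. c * A y x)"

definition opeq :: "'v set set \<Rightarrow> 'v op \<Rightarrow> 'v op \<Rightarrow> bool" where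
  "opeq L A B \<longleftrightarrow> (\<forall>y\<in>L. \<forall>x\<in>L. A y x = B y x)"

definition opinvertible :: "'v set set \<Rightarrow> 'v op \<Rightarrow> bool" where
  "opinvertible L A \<longleftrightarrow> (\<exists>N. opeq L (opmul L A N) opid \<and> opeq L (opmul L N A) opid)"

definition opinv :: "'v set set \<Rightarrow> 'v op \<Rightarrow> 'v op" where
  "opinv L A = (SOME N. opeq L (opmul L A N) opid \<and> opeq L (opmul L N A) opid)"

definition comm :: "'v set set \<Rightarrow> 'v op \<Rightarrow> 'v op \<Rightarrow> 'v op" where
  "comm L A B = (\<lambda>y x. opmul L A B y x - opmul L B A y x)"

definition qcomm :: "complex \<Rightarrow> 'v set set \<Rightarrow> 'v op \<Rightarrow> 'v op \<Rightarrow> 'v op" where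
  "qcomm q L A B = (\<lambda>y x. q * opmul L A B y x - inverse q * opmul L B A y x)"

definition L1op :: "('a::field \<Rightarrow> 'v::ab_group_add \<Rightarrow> 'v) \<Rightarrow> 'v set \<Rightarrow> 'v op" where
  "L1op sc x0 = (\<lambda>y x. if covby sc y x \<and> y \<inter> x0 = x \<inter> x0 then 1 else 0)"

definition L2op :: "('a::field \<Rightarrow> 'v::ab_group_add \<Rightarrow> 'v) \<Rightarrow> 'v set \<Rightarrow> 'v op" where
  "L2op sc x0 = (\<lambda>y x. if covby sc y x \<and> ssum y x0 = ssum x x0 then 1 else 0)"

definition R1op :: "('a::field \<Rightarrow> 'v::ab_group_add \<Rightarrow> 'v) \<Rightarrow> 'v set \<Rightarrow> 'v op" where
  "R1op sc x0 = (\<lambda>y x. if covby sc x y \<and> y \<inter> x0 = x \<inter> x0 then 1 else 0)"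

definition R2op :: "('a::field \<Rightarrow> 'v::ab_group_add \<Rightarrow> 'v) \<Rightarrow> 'v set \<Rightarrow> 'v op" where
  "R2op sc x0 = (\<lambda>y x. if covby sc x y \<and> ssum y x0 = ssum x x0 then 1 else 0)"

text \<open>D1 x = q^(dim(Omega/x0) - 2 dim((x+x0)/x0)) x, with dim(U/W) = dim U - dim W for W \<subseteq> U\<close>
definition D1op :: "('a::{field,finite} \<Rightarrow> 'v::ab_group_add \<Rightarrow> 'v) \<Rightarrow> 'v set \<Rightarrow> 'v set \<Rightarrow> 'v op" where
  "D1op sc Om x0 = (\<lambda>y x. if y = x then
      qq TYPE('a) powi ((int (vdim sc Om) - int (vdim sc x0))
                         - 2 * (int (vdim sc (ssum x x0)) - int (vdim sc x0)))
      else 0)"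

definition D2op :: "('a::{field,finite} \<Rightarrow> 'v::ab_group_add \<Rightarrow> 'v) \<Rightarrow> 'v set \<Rightarrow> 'v op" where
  "D2op sc x0 = (\<lambda>y x. if y = x then
      qq TYPE('a) powi (int (vdim sc x0) - 2 * int (vdim sc (x \<inter> x0)))
      else 0)"

definition D3op :: "('a::field \<Rightarrow> 'v::ab_group_add \<Rightarrow> 'v) \<Rightarrow> 'v set \<Rightarrow> 'v set \<Rightarrow> 'v op" where
  "D3op sc x0 x1 = (\<lambda>y x. if ssum y x0 = ssum x x0 \<and> y \<inter> x0 = x \<inter> x0
                              \<and> tau_rank_diff sc x0 x1 y x = 1 then 1 else 0)"

definition D4op :: "'v::ab_group_add set \<Rightarrow> 'v op" where
  "D4op x0 = (\<lambda>y x. if y = x then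
      (of_nat (card x) + of_nat (card x0)) / of_nat (card (x \<inter> x0)) - 1 else 0)"

definition Mop :: "('a::{field,finite} \<Rightarrow> 'v::ab_group_add \<Rightarrow> 'v) \<Rightarrow> 'v set \<Rightarrow> 'v set \<Rightarrow> 'v op" where
  "Mop sc x0 x1 = opadd (opsmult ((qq TYPE('a))\<^sup>2 - 1) (D3op sc x0 x1)) (D4op x0)"

text \<open>A W_q-module structure on C^L is the same as an assignment of the generators
  E1,E2,F1,F2,K1,K1^-1,K2,K2^-1,I,I^-1 to operators satisfying the defining relations.\<close>
definition Wq_relations :: "complex \<Rightarrow> 'v set set \<Rightarrow> 'v op \<Rightarrow> 'v op \<Rightarrow> 'v op \<Rightarrow> 'v op
     \<Rightarrow> 'v op \<Rightarrow> 'v op \<Rightarrow> 'v op \<Rightarrow> 'v op \<Rightarrow> 'v op \<Rightarrow> 'v op \<Rightarrow> bool" where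
  "Wq_relations q L E1 E2 F1 F2 K1 K1i K2 K2i I Ii \<longleftrightarrow>
     \<comment> \<open>I central\<close>
     (\<forall>X\<in>{E1, E2, F1, F2, K1, K1i, K2, K2i, I, Ii}. opeq L (comm L I X) opzero
                                                  \<and> opeq L (comm L Ii X) opzero) \<and>
     \<comment> \<open>inverses\<close>
     opeq L (opmul L I Ii) opid \<and> opeq L (opmul L Ii I) opid \<and>
     opeq L (opmul L K1 K1i) opid \<and> opeq L (opmul L K1i K1) opid \<and>
     opeq L (opmul L K2 K2i) opid \<and> opeq L (opmul L K2i K2) opid \<and>
     \<comment> \<open>commutators\<close>
     opeq L (comm L K1 E2) opzero \<and> opeq L (comm L K1 F2) opzero \<and>
     opeq L (comm L K1 K2) opzero \<and> opeq L (comm L K2 E1) opzero \<and>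
     opeq L (comm L K2 F1) opzero \<and>
     \<comment> \<open>q-commutators\<close>
     opeq L (qcomm q L E1 K1) opzero \<and> opeq L (qcomm q L K1 F1) opzero \<and>
     opeq L (qcomm q L E2 K2) opzero \<and> opeq L (qcomm q L K2 F2) opzero \<and>
     opeq L (comm L E1 E2) opzero \<and> opeq L (comm L E1 F2) opzero \<and>
     opeq L (comm L F1 E2) opzero \<and> opeq L (comm L F1 F2) opzero \<and>
     opeq L (comm L E1 F1) (\<lambda>y x. (K1 y x - opmul L I K1i y x) / (q - inverse q)) \<and>
     opeq L (comm L E2 F2) (\<lambda>y x. (opmul L I K2 y x - K2i y x) / (q - inverse q))"

end

theory Submission
  imports Defs "HOL-Library.Cardinality"
begin

text \<open>
  Write \<open>Q = q\<^sup>2\<close> for the size of the field. For \<open>y \<subseteq> x\<close> of codimension one, \<open>dim (y \<inter> x0)\<close> either equals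
  \<open>dim (x \<inter> x0)\<close> or drops by one; these two cases are \<open>L1\<close> and \<open>L2\<close>, and \<open>R1\<close>, \<open>R2\<close> are their transposes.
  The preimage of the image of \<open>\<tau>(y) - \<tau>(x)\<close> is \<open>(x + y) \<inter> x0\<close>, so every matrix entry depends only on
  dimensions of \<open>x\<close>, \<open>y\<close>, \<open>x + y\<close>, \<open>x \<inter> y\<close> and of their intersections with \<open>x0\<close>. Comparing entries yields
  \<open>L1 L2 = Q L2 L1\<close>, \<open>L1 R2 = R2 L1\<close> and, with \<open>M = (Q - 1) D3 + D4\<close>,
  \<open>(Q - 1) [L1, R1] = q\<^sup>D D1 D2 - M\<close> and \<open>(Q - 1) [L2, R2] = M - q\<^sup>D (D1 D2)\<^sup>-\<^sup>1\<close>; the diagonal entries are counts of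
  covers and hyperplanes. The two expressions for \<open>M\<close> give its commutation with \<open>L2\<close>, \<open>R2\<close> and with \<open>L1\<close>, \<open>R1\<close>,
  hence the centrality of \<open>I\<close>. Invertibility holds because \<open>M\<close> is a positive diagonal matrix plus a
  Gram matrix.
\<close>

section \<open>Operators indexed by a finite set\<close>

text \<open>Apart from the inverse laws and the two relations for \<open>[E1, F1]\<close> and
  \<open>[E2, F2]\<close>, every relation has the form \<open>A B = s B A\<close> with a scalar
  \<open>s\<close>. These scalars multiply along products and invert for inverses, so centrality of
  \<open>I\<close> only asks that the three scalars coming from \<open>D1\<close>, the inverse of
  \<open>D2\<close> and \<open>M\<close> have product 1. The obstacle is \<open>M\<close>:
  multiplying \<open>D3\<close> by \<open>L1\<close> or \<open>R2\<close> entrywise would mean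
  counting subspaces with prescribed rank. This is avoided because each expression of
  \<open>M\<close> as diagonal plus commutator involves only one of the pairs
  \<open>(L1, R1)\<close>, \<open>(L2, R2)\<close>, while the operators of the other pair commute up
  to a scalar with both of its members. Off the diagonal, products of a lowering and a raising
  operator have entries 0 or 1, since two distinct subspaces have at most one common cover and at
  most one common hyperplane. Equality of entries thereby becomes an equivalence of linear
  conditions on dimensions. The powers of q in front of \<open>E1\<close>, \<open>E2\<close>,
  \<open>F1\<close>, \<open>F2\<close> matter only through their product \<open>q * q^(-D)\<close>;
  the extra q comes from \<open>q^2 - 1 = q (q - 1/q)\<close>.\<close>

definition diag_op :: "('v set \<Rightarrow> complex) \<Rightarrow> 'v op" where
  "diag_op d = (\<lambda>y x. if y = x then d x else 0)"

definition inverse_pair :: "'v set set \<Rightarrow> 'v op \<Rightarrow> 'v op \<Rightarrow> bool" where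
  "inverse_pair L A N \<longleftrightarrow> opeq L (opmul L A N) opid \<and> opeq L (opmul L N A) opid"

text \<open>The case \<open>s = 1\<close> is commuting and \<open>s = 1/q^2\<close> is the vanishing
  of the q-commutator, so one calculus serves both kinds of relation.\<close>

definition qcommute :: "'v set set \<Rightarrow> complex \<Rightarrow> 'v op \<Rightarrow> 'v op \<Rightarrow> bool" where
  "qcommute L s A B \<longleftrightarrow> opeq L (opmul L A B) (opsmult s (opmul L B A))"

lemma opeq_refl [simp]: "opeq L A A"
  by (simp add: opeq_def)

lemma opeq_sym: "opeq L A B \<Longrightarrow> opeq L B A"
  by (simp add: opeq_def)

lemma opeq_trans [trans]: "opeq L A B \<Longrightarrow> opeq L B C \<Longrightarrow> opeq L A C"
  by (simp add: opeq_def)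

lemma opeq_opmul: "opeq L A A' \<Longrightarrow> opeq L B B' \<Longrightarrow> opeq L (opmul L A B) (opmul L A' B')"
  by (simp add: opeq_def opmul_def)

lemma opeq_opsmult: "opeq L A A' \<Longrightarrow> opeq L (opsmult c A) (opsmult c A')"
  by (simp add: opeq_def opsmult_def)

lemma opmul_assoc: "finite L \<Longrightarrow> opmul L (opmul L A B) C = opmul L A (opmul L B C)"
  unfolding opmul_def
  by (auto simp: fun_eq_iff sum_distrib_left sum_distrib_right mult.assoc intro: sum.swap)

lemma opmul_opsmult_left: "opmul L (opsmult c A) B = opsmult c (opmul L A B)"
  by (simp add: fun_eq_iff opmul_def opsmult_def sum_distrib_left mult.assoc)

lemma opmul_opsmult_right: "opmul L A (opsmult c B) = opsmult c (opmul L A B)"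
  by (simp add: fun_eq_iff opmul_def opsmult_def sum_distrib_left mult_ac)

lemma opsmult_opsmult: "opsmult c (opsmult d A) = opsmult (c * d) A"
  by (simp add: fun_eq_iff opsmult_def mult.assoc)

lemma opsmult_1 [simp]: "opsmult 1 A = A"
  by (simp add: fun_eq_iff opsmult_def)

lemma opmul_diag_left:
  assumes "finite L" "y \<in> L"
  shows "opmul L (diag_op d) A y x = d y * A y x"
  using assms by (simp add: opmul_def diag_op_def if_distrib[of "\<lambda>t. t * _"] sum.delta cong: if_cong)

lemma opmul_diag_right:
  assumes "finite L" "x \<in> L"
  shows "opmul L A (diag_op d) y x = A y x * d x"
  using assms by (simp add: opmul_def diag_op_def if_distrib[of "\<lambda>t. _ * t"] sum.delta' cong: if_cong)

lemma opid_eq_diag: "opid = diag_op (\<lambda>_. 1)"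
  by (simp add: opid_def diag_op_def fun_eq_iff)

lemma opmul_opid_left: "finite L \<Longrightarrow> opeq L (opmul L opid A) A"
  by (simp add: opeq_def opid_eq_diag opmul_diag_left)

lemma opmul_opid_right: "finite L \<Longrightarrow> opeq L (opmul L A opid) A"
  by (simp add: opeq_def opid_eq_diag opmul_diag_right)

lemma inverse_pair_sym: "inverse_pair L A N \<Longrightarrow> inverse_pair L N A"
  by (simp add: inverse_pair_def)

lemma inverse_pair_unique:
  assumes "finite L" "inverse_pair L A N" "inverse_pair L A N'"
  shows "opeq L N N'"
proof -
  have "opeq L N (opmul L N opid)"
    using assms by (blast intro: opmul_opid_right opeq_sym)
  also have "opeq L \<dots> (opmul L N (opmul L A N'))"
    using assms by (auto intro: opeq_opmul opeq_sym simp: inverse_pair_def)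
  also have "opeq L \<dots> (opmul L (opmul L N A) N')"
    using assms by (simp add: opmul_assoc)
  also have "opeq L \<dots> (opmul L opid N')"
    using assms by (auto intro: opeq_opmul simp: inverse_pair_def)
  also have "opeq L \<dots> N'"
    using assms by (blast intro: opmul_opid_left)
  finally show ?thesis .
qed

lemma inverse_pair_opinv:
  assumes "inverse_pair L A N"
  shows "inverse_pair L A (opinv L A)"
  unfolding opinv_def inverse_pair_def
  by (rule someI[where x = N]) (use assms in \<open>simp add: inverse_pair_def\<close>)

lemma inverse_pair_diag:
  assumes "finite L" "\<And>x. x \<in> L \<Longrightarrow> d x \<noteq> 0"
  shows "inverse_pair L (diag_op d) (diag_op (\<lambda>x. inverse (d x)))"
  using assms by (auto simp: inverse_pair_def opeq_def opmul_diag_left) (auto simp: diag_op_def opid_def)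

text \<open>\<open>opinv\<close> is a choice whose entries outside \<open>L\<close> are arbitrary;
  uniqueness of inverses pins it down on \<open>L\<close> only, hence \<open>opeq\<close> instead of
  an equation.\<close>

lemma opinv_diag:
  assumes "finite L" "\<And>x. x \<in> L \<Longrightarrow> d x \<noteq> 0"
  shows "opeq L (opinv L (diag_op d)) (diag_op (\<lambda>x. inverse (d x)))"
  using assms inverse_pair_diag inverse_pair_opinv inverse_pair_unique by metis

section \<open>Calculus of commutation up to a scalar\<close>

lemma qcommute_cong:
  assumes "opeq L A A'" "opeq L B B'" "qcommute L s A' B'"
  shows "qcommute L s A B"
proof -
  have "opeq L (opmul L A B) (opmul L A' B')"
    using assms by (intro opeq_opmul)
  also have "opeq L \<dots> (opsmult s (opmul L B' A'))"
    using assms by (simp add: qcommute_def)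
  also have "opeq L \<dots> (opsmult s (opmul L B A))"
    using assms by (intro opeq_opsmult opeq_opmul) (auto intro: opeq_sym)
  finally show ?thesis
    by (simp add: qcommute_def)
qed

lemma qcommute_flip:
  assumes "qcommute L s A B" "s * t = 1"
  shows "qcommute L t B A"
proof -
  have "t * (s * c) = c" for c
    using assms(2) by (metis mult.assoc mult.commute mult_1)
  then show ?thesis
    using assms(1) by (simp add: qcommute_def opeq_def opsmult_def)
qed

lemma qcommute_opmul:
  assumes "finite L" "qcommute L s A B" "qcommute L t A C"
  shows "qcommute L (s * t) A (opmul L B C)"
proof -
  have "opeq L (opmul L A (opmul L B C)) (opmul L (opmul L A B) C)"
    using assms by (simp add: opmul_assoc)
  also have "opeq L \<dots> (opmul L (opsmult s (opmul L B A)) C)"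
    using assms by (intro opeq_opmul) (auto simp: qcommute_def)
  also have "opeq L \<dots> (opsmult s (opmul L B (opmul L A C)))"
    using assms by (simp add: opmul_assoc opmul_opsmult_left)
  also have "opeq L \<dots> (opsmult s (opmul L B (opsmult t (opmul L C A))))"
    using assms by (intro opeq_opsmult opeq_opmul) (auto simp: qcommute_def)
  also have "opeq L \<dots> (opsmult (s * t) (opmul L (opmul L B C) A))"
    using assms by (simp add: opmul_assoc opmul_opsmult_right opsmult_opsmult)
  finally show ?thesis
    by (simp add: qcommute_def)
qed

lemma qcommute_opsmult: "qcommute L s A B \<Longrightarrow> qcommute L s A (opsmult c B)"
  by (simp add: qcommute_def opmul_opsmult_left opmul_opsmult_right)
    (simp add: opeq_def opsmult_def mult_ac)

lemma qcommute_opadd: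
  "qcommute L s A B \<Longrightarrow> qcommute L s A C \<Longrightarrow> qcommute L s A (opadd B C)"
  by (simp add: qcommute_def opeq_def opmul_def opsmult_def opadd_def sum.distrib algebra_simps)

lemma qcommute_comm:
  assumes "finite L" "qcommute L s A B" "qcommute L t A C"
  shows "qcommute L (s * t) A (comm L B C)"
proof -
  have "comm L B C = opadd (opmul L B C) (opsmult (-1) (opmul L C B))"
    by (simp add: fun_eq_iff comm_def opadd_def opsmult_def)
  then show ?thesis
    using qcommute_opmul[OF assms] qcommute_opmul[OF assms(1,3,2)]
    by (simp add: qcommute_opadd qcommute_opsmult mult.commute)
qed

text \<open>A diagonal factor on the right weights columns, one on the left weights rows; it
  therefore suffices that the weight changes by the same factor across every nonzero entry of
  \<open>A\<close>.\<close>

lemma qcommute_diag: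
  assumes "finite L" "\<And>y x. y \<in> L \<Longrightarrow> x \<in> L \<Longrightarrow> A y x \<noteq> 0 \<Longrightarrow> d x = s * d y"
  shows "qcommute L s A (diag_op d)"
proof -
  have "A y x * d x = s * (d y * A y x)" if "y \<in> L" "x \<in> L" for y x
    using assms(2)[OF that] by (cases "A y x = 0") auto
  then show ?thesis
    using assms(1) by (simp add: qcommute_def opeq_def opsmult_def opmul_diag_left opmul_diag_right)
qed

lemma qcommute_inverse:
  assumes "finite L" "inverse_pair L B N" "qcommute L s A B" "s * t = 1"
  shows "qcommute L t A N"
proof -
  have id: "opeq L (opmul L N B) opid" "opeq L (opmul L B N) opid"
    using assms by (auto simp: inverse_pair_def)
  have "opeq L (opmul L A N) (opmul L (opmul L opid A) N)"
    using assms by (intro opeq_opmul opeq_sym[OF opmul_opid_left]) auto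
  also have "opeq L \<dots> (opmul L (opmul L (opmul L N B) A) N)"
    using id by (intro opeq_opmul) (auto intro: opeq_sym)
  also have "opeq L \<dots> (opmul L N (opmul L (opmul L B A) N))"
    using assms by (simp add: opmul_assoc)
  also have "opeq L \<dots> (opmul L N (opmul L (opsmult t (opmul L A B)) N))"
    using qcommute_flip[OF assms(3,4)] by (intro opeq_opmul) (auto simp: qcommute_def)
  also have "opeq L \<dots> (opsmult t (opmul L (opmul L N A) (opmul L B N)))"
    using assms by (simp add: opmul_assoc opmul_opsmult_left opmul_opsmult_right)
  also have "opeq L \<dots> (opsmult t (opmul L (opmul L N A) opid))"
    using id by (intro opeq_opsmult opeq_opmul) auto
  also have "opeq L \<dots> (opsmult t (opmul L N A))"
    using assms by (intro opeq_opsmult opmul_opid_right)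
  finally show ?thesis
    by (simp add: qcommute_def)
qed

text \<open>Since the factors commute, the inverse may list the inverse factors in the same order,
  which is the order used for the inverse of \<open>I\<close>.\<close>

lemma inverse_pair_opmul:
  assumes "finite L" "inverse_pair L A A'" "inverse_pair L B B'" "qcommute L 1 A B"
  shows "inverse_pair L (opmul L A B) (opmul L A' B')"
proof -
  have cancel: "opeq L (opmul L (opmul L A B) (opmul L A' B')) opid"
    if "opeq L (opmul L A A') opid" "opeq L (opmul L B B') opid" "qcommute L 1 B A'" for A A' B B'
  proof -
    have "opeq L (opmul L (opmul L A B) (opmul L A' B')) (opmul L A (opmul L (opmul L B A') B'))"
      using assms(1) by (simp add: opmul_assoc)
    also have "opeq L \<dots> (opmul L A (opmul L (opmul L A' B) B'))"
      using that by (intro opeq_opmul[OF opeq_refl opeq_opmul[OF _ opeq_refl]]) (simp add: qcommute_def)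
    also have "opeq L \<dots> (opmul L (opmul L A A') (opmul L B B'))"
      using assms(1) by (simp add: opmul_assoc)
    also have "opeq L \<dots> (opmul L opid opid)"
      using that by (intro opeq_opmul)
    also have "opeq L \<dots> opid"
      using assms(1) by (rule opmul_opid_left)
    finally show ?thesis .
  qed
  have "qcommute L 1 B A'"
    using assms by (intro qcommute_inverse[of L A A' 1 B 1] qcommute_flip[of L 1 A B 1]) auto
  moreover have "qcommute L 1 B' A"
    using assms by (intro qcommute_flip[of L 1 A B' 1] qcommute_inverse[of L B B' 1 A 1]) auto
  ultimately show ?thesis
    using assms cancel by (simp add: inverse_pair_def)
qed

lemma inverse_pair_opsmult:
  assumes "inverse_pair L A N" "c * d = 1"
  shows "inverse_pair L (opsmult c A) (opsmult d N)"
  using assms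
  by (simp add: inverse_pair_def opmul_opsmult_left opmul_opsmult_right opsmult_opsmult mult.commute)

lemma comm_zero_iff_qcommute: "opeq L (comm L A B) opzero \<longleftrightarrow> qcommute L 1 A B"
  by (simp add: opeq_def comm_def opzero_def qcommute_def)

lemma qcomm_zero_iff_qcommute:
  assumes "q \<noteq> 0"
  shows "opeq L (qcomm q L A B) opzero \<longleftrightarrow> qcommute L (inverse (q\<^sup>2)) A B"
proof -
  have "q * u - inverse q * v = 0 \<longleftrightarrow> u = inverse (q\<^sup>2) * v" for u v
    using assms by (simp add: field_simps power2_eq_square)
  then show ?thesis
    by (simp add: opeq_def qcomm_def opzero_def qcommute_def opsmult_def)
qed

section \<open>Invertibility of a positive diagonal matrix plus a Gram matrix\<close>

text \<open>The Schur complement of the principal submatrix on \<open>S\<close> inside the one on \<open>insert a S\<close> cannot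
  vanish, as it would yield a kernel vector with entry \<open>1\<close> at \<open>a\<close>.\<close>

lemma linear_system_solvable:
  fixes A :: "'b \<Rightarrow> 'b \<Rightarrow> 'c::field"
  assumes "finite S"
    and "\<And>T f x. T \<subseteq> S \<Longrightarrow> (\<And>z. z \<in> T \<Longrightarrow> (\<Sum>x\<in>T. A z x * f x) = 0) \<Longrightarrow> x \<in> T \<Longrightarrow> f x = 0"
  shows "\<exists>f. \<forall>z\<in>S. (\<Sum>x\<in>S. A z x * f x) = g z"
  using assms
proof (induction S arbitrary: g rule: finite_induct)
  case (insert a S)
  have IH: "\<exists>f. \<forall>z\<in>S. (\<Sum>x\<in>S. A z x * f x) = g z" for g
    using insert.prems by (intro insert.IH) (meson subset_insertI2)
  obtain f1 where f1: "\<And>z. z \<in> S \<Longrightarrow> (\<Sum>x\<in>S. A z x * f1 x) = g z"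
    using IH by blast
  obtain f2 where f2: "\<And>z. z \<in> S \<Longrightarrow> (\<Sum>x\<in>S. A z x * f2 x) = A z a"
    using IH[of "\<lambda>z. A z a"] by blast
  define s where "s = A a a - (\<Sum>x\<in>S. A a x * f2 x)"
  have split: "(\<Sum>x\<in>insert a S. A z x * (if x = a then t else f x)) = A z a * t + (\<Sum>x\<in>S. A z x * f x)" for z t f
  proof -
    have "(\<Sum>x\<in>S. A z x * (if x = a then t else f x)) = (\<Sum>x\<in>S. A z x * f x)"
      using insert.hyps by (intro sum.cong) auto
    then show ?thesis
      using insert.hyps by simp
  qed
  have "s \<noteq> 0"
  proof
    assume "s = 0"
    let ?h = "\<lambda>x. if x = a then 1 else - f2 x"
    have "?h a = 0"
    proof (rule insert.prems[of "insert a S" ?h a])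
      fix z assume "z \<in> insert a S"
      then show "(\<Sum>x\<in>insert a S. A z x * ?h x) = 0"
        unfolding split using \<open>s = 0\<close> f2 by (auto simp: sum_negf s_def)
    qed simp_all
    then show False by simp
  qed
  \<comment> \<open>Putting \<open>t\<close> at \<open>a\<close> and \<open>f1 - t * f2\<close> on
    \<open>S\<close> satisfies the rows in \<open>S\<close> for every \<open>t\<close>, because
    \<open>f2\<close> reproduces column \<open>a\<close> there. Row \<open>a\<close> then reads
    \<open>t * s\<close> = right-hand side of this definition times \<open>s\<close>.\<close>
  define t where "t = (g a - (\<Sum>x\<in>S. A a x * f1 x)) / s"
  have "(\<Sum>x\<in>insert a S. A z x * (if x = a then t else f1 x - t * f2 x)) = g z" if z: "z \<in> insert a S" for z
  proof -
    have diff: "(\<Sum>x\<in>S. A z x * (f1 x - t * f2 x)) = (\<Sum>x\<in>S. A z x * f1 x) - t * (\<Sum>x\<in>S. A z x * f2 x)"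
      by (simp add: sum_subtractf sum_distrib_left algebra_simps)
    have "A a a * t + ((\<Sum>x\<in>S. A a x * f1 x) - t * (\<Sum>x\<in>S. A a x * f2 x)) = (\<Sum>x\<in>S. A a x * f1 x) + t * s"
      by (simp add: s_def right_diff_distrib mult.commute)
    also have "\<dots> = g a"
      using \<open>s \<noteq> 0\<close> by (simp add: t_def)
    finally show ?thesis
      unfolding split diff using z f1 f2 by auto
  qed
  then show ?case
    by (intro exI[of _ "\<lambda>x. if x = a then t else f1 x - t * f2 x"] ballI)
qed simp

text \<open>Pairing the kernel equation with the conjugate of \<open>f\<close> turns it into a
  vanishing sum of the terms \<open>c z * |f z|^2\<close> and \<open>t * |v i|^2\<close>, all
  nonnegative, where \<open>v i\<close> pairs the \<open>i\<close>-th Gram vector with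
  \<open>f\<close>. The index set \<open>T\<close> is kept free because
  \<open>linear_system_solvable\<close> asks about every principal submatrix.\<close>

lemma gram_kernel_trivial:
  fixes c :: "'b \<Rightarrow> real" and s :: "'i \<Rightarrow> 'b \<Rightarrow> real" and f :: "'b \<Rightarrow> complex"
  assumes T: "finite T" and c: "\<And>x. x \<in> T \<Longrightarrow> 0 < c x" and t: "0 \<le> t"
    and A: "\<And>z x. z \<in> T \<Longrightarrow> x \<in> T \<Longrightarrow>
      A z x = complex_of_real ((if z = x then c x else 0) + t * (\<Sum>i\<in>J. s i z * s i x))"
    and ker: "\<And>z. z \<in> T \<Longrightarrow> (\<Sum>x\<in>T. A z x * f x) = 0"
    and x: "x \<in> T"
  shows "f x = 0"
proof -
  define v where "v i = (\<Sum>x\<in>T. complex_of_real (s i x) * f x)" for i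
  have row: "(\<Sum>x\<in>T. A z x * f x) = complex_of_real (c z) * f z + (\<Sum>i\<in>J. complex_of_real (t * s i z) * v i)"
    if z: "z \<in> T" for z
  proof -
    have "(\<Sum>x\<in>T. A z x * f x) = (\<Sum>x\<in>T. complex_of_real (if z = x then c x else 0) * f x
        + (\<Sum>i\<in>J. complex_of_real (t * s i z) * (complex_of_real (s i x) * f x)))"
      using z by (intro sum.cong) (simp_all add: A distrib_right distrib_left sum_distrib_left sum_distrib_right mult_ac)
    also have "\<dots> = complex_of_real (c z) * f z + (\<Sum>i\<in>J. complex_of_real (t * s i z) * v i)"
    proof -
      have "(\<Sum>x\<in>T. complex_of_real (if z = x then c x else 0) * f x) =
          (\<Sum>x\<in>T. if z = x then complex_of_real (c x) * f x else 0)"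
        by (intro sum.cong) auto
      then show ?thesis
        using z T by (simp add: sum.distrib v_def sum_distrib_left sum.swap[of _ T J])
    qed
    finally show ?thesis .
  qed
  have "0 = (\<Sum>z\<in>T. cnj (f z) * (\<Sum>x\<in>T. A z x * f x))"
    by (simp add: ker)
  also have "\<dots> = (\<Sum>z\<in>T. complex_of_real (c z) * (f z * cnj (f z))) +
      (\<Sum>z\<in>T. \<Sum>i\<in>J. complex_of_real t * (complex_of_real (s i z) * cnj (f z)) * v i)"
    by (subst sum.cong[OF refl row[THEN arg_cong]])
      (simp_all add: distrib_left sum.distrib sum_distrib_left mult_ac)
  also have "(\<Sum>z\<in>T. \<Sum>i\<in>J. complex_of_real t * (complex_of_real (s i z) * cnj (f z)) * v i) =
      (\<Sum>i\<in>J. complex_of_real t * (v i * cnj (v i)))"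
  proof (subst sum.swap, intro sum.cong refl)
    fix i
    have "cnj (v i) = (\<Sum>z\<in>T. complex_of_real (s i z) * cnj (f z))"
      by (simp add: v_def)
    then show "(\<Sum>z\<in>T. complex_of_real t * (complex_of_real (s i z) * cnj (f z)) * v i) =
        complex_of_real t * (v i * cnj (v i))"
      by (simp add: sum_distrib_left mult_ac)
  qed
  finally have "0 = complex_of_real ((\<Sum>z\<in>T. c z * (cmod (f z))\<^sup>2) + (\<Sum>i\<in>J. t * (cmod (v i))\<^sup>2))"
    by (simp only: complex_norm_square[symmetric] of_real_mult[symmetric] of_real_sum[symmetric] of_real_add[symmetric])
  then have "(\<Sum>z\<in>T. c z * (cmod (f z))\<^sup>2) + (\<Sum>i\<in>J. t * (cmod (v i))\<^sup>2) = 0"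
    by (rule of_real_eq_0_iff[THEN iffD1, OF sym])
  moreover have "0 \<le> (\<Sum>i\<in>J. t * (cmod (v i))\<^sup>2)"
    using t by (simp add: sum_nonneg)
  moreover have nonneg: "0 \<le> c z * (cmod (f z))\<^sup>2" if "z \<in> T" for z
    using c[OF that] by simp
  ultimately have "(\<Sum>z\<in>T. c z * (cmod (f z))\<^sup>2) = 0"
    using sum_nonneg[of T "\<lambda>z. c z * (cmod (f z))\<^sup>2"] by fastforce
  then have "c x * (cmod (f x))\<^sup>2 = 0"
    using T nonneg x by (subst (asm) sum_nonneg_eq_0_iff) auto
  then show ?thesis
    using c[OF x] by simp
qed

text \<open>Solving for each unit vector gives a right inverse \<open>N\<close>. The matrix is
  symmetric, so the transpose \<open>N'\<close> is a left inverse, and a left and a right inverse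
  coincide on \<open>L\<close>.\<close>

lemma opinvertible_gram:
  fixes c :: "'v set \<Rightarrow> real" and s :: "'i \<Rightarrow> 'v set \<Rightarrow> real"
  assumes L: "finite L" and c: "\<And>x. x \<in> L \<Longrightarrow> 0 < c x" and t: "0 \<le> t"
    and A: "\<And>z x. z \<in> L \<Longrightarrow> x \<in> L \<Longrightarrow>
      A z x = complex_of_real ((if z = x then c x else 0) + t * (\<Sum>i\<in>J. s i z * s i x))"
  shows "opinvertible L A"
proof -
  have sol: "\<exists>f. \<forall>z\<in>L. (\<Sum>x\<in>L. A z x * f x) = g z" for g
  proof (rule linear_system_solvable[OF L])
    fix T f x
    assume "T \<subseteq> L" "\<And>z. z \<in> T \<Longrightarrow> (\<Sum>x\<in>T. A z x * f x) = 0" "x \<in> T"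
    then show "f x = 0"
      using L c t A finite_subset[of T L] by (intro gram_kernel_trivial[of T c t A s J f x]) (auto simp: subset_iff)
  qed
  have "\<forall>x. \<exists>f. \<forall>z\<in>L. (\<Sum>y\<in>L. A z y * f y) = opid z x"
    by (intro allI sol)
  then obtain F where F: "\<And>x z. z \<in> L \<Longrightarrow> (\<Sum>y\<in>L. A z y * F x y) = opid z x"
    by metis
  define N N' where "N = (\<lambda>y x. F x y)" and "N' = (\<lambda>y x. F y x)"
  have sym: "A z x = A x z" if "z \<in> L" "x \<in> L" for z x
    using that by (simp add: A mult.commute)
  have right: "opeq L (opmul L A N) opid"
    using F by (simp add: opeq_def opmul_def N_def)
  have left: "opeq L (opmul L N' A) opid"
  proof -
    have "(\<Sum>z\<in>L. N' y z * A z x) = opid y x" if "y \<in> L" "x \<in> L" for y x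
    proof -
      have "(\<Sum>z\<in>L. N' y z * A z x) = (\<Sum>z\<in>L. A x z * F y z)"
        using that sym by (intro sum.cong) (auto simp: N'_def)
      then show ?thesis
        using F[OF that(2), of y] by (auto simp: opid_def)
    qed
    then show ?thesis
      by (simp add: opeq_def opmul_def)
  qed
  have "opeq L N (opmul L opid N)"
    by (rule opeq_sym[OF opmul_opid_left[OF L]])
  also have "opeq L \<dots> (opmul L (opmul L N' A) N)"
    using left by (intro opeq_opmul) (auto intro: opeq_sym)
  also have "opeq L \<dots> (opmul L N' (opmul L A N))"
    using L by (simp add: opmul_assoc)
  also have "opeq L \<dots> (opmul L N' opid)"
    using right by (intro opeq_opmul) auto
  also have "opeq L \<dots> N'"
    using L by (rule opmul_opid_right)
  finally have "opeq L (opmul L N A) (opmul L N' A)"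
    by (intro opeq_opmul) auto
  then have "opeq L (opmul L N A) opid"
    using left opeq_trans by blast
  with right show ?thesis
    by (auto simp: opinvertible_def)
qed

lemma qcommute_refl [simp]: "qcommute L 1 A A"
  by (simp add: qcommute_def)

lemma qcommute_opmul_left:
  assumes "finite L" "qcommute L s A C" "qcommute L t B C" "s \<noteq> 0" "t \<noteq> 0"
  shows "qcommute L (s * t) (opmul L A B) C"
proof (rule qcommute_flip)
  show "qcommute L (inverse s * inverse t) C (opmul L A B)"
    using assms by (intro qcommute_opmul) (auto intro: qcommute_flip)
qed (use assms in \<open>simp add: field_simps\<close>)

lemma qcommute_opsmult_left: "qcommute L s A B \<Longrightarrow> qcommute L s (opsmult c A) B"
  by (simp add: qcommute_def opmul_opsmult_left opmul_opsmult_right)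
    (simp add: opeq_def opsmult_def mult_ac)

lemma qcommute_diag_diag: "finite L \<Longrightarrow> qcommute L 1 (diag_op d) (diag_op e)"
  by (rule qcommute_diag) (auto simp: diag_op_def split: if_splits)

lemma qcommute_opeq_right: "opeq L B B' \<Longrightarrow> qcommute L s A B' \<Longrightarrow> qcommute L s A B"
  by (rule qcommute_cong[OF opeq_refl])

lemma qq_sq: "(qq TYPE('a::finite))\<^sup>2 = of_nat CARD('a)"
  by (simp add: qq_def flip: of_real_power)

section \<open>Counting subspaces over a finite field\<close>

context vector_space
begin

text \<open>These coordinates show that spans of finite sets are finite over a finite field; when
  \<open>b\<close> lies outside \<open>span B\<close> they are injective, and each new basis vector
  multiplies the cardinality by the size of the field.\<close>

lemma span_insert_image: "span (insert b B) = (\<lambda>(k, v). k *s b + v) ` (UNIV \<times> span B)"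
proof -
  have "x \<in> (\<lambda>(k, v). k *s b + v) ` (UNIV \<times> span B)" if "x - k *s b \<in> span B" for x k
    using that by (intro image_eqI[of _ _ "(k, x - k *s b)"]) auto
  moreover have "\<exists>j. k *s b + v - j *s b \<in> span B" if "v \<in> span B" for k v
    using that by (intro exI[of _ k]) simp
  ultimately show ?thesis
    by (auto simp: span_insert)
qed

end

locale finite_field_space = vector_space sc
  for sc :: "'a::{field,finite} \<Rightarrow> 'v::ab_group_add \<Rightarrow> 'v"
begin

lemma finite_span: "finite B \<Longrightarrow> finite (span B)"
  by (induction B rule: finite_induct) (simp_all add: span_insert_image)

lemma card_span_independent:
  assumes "finite B" "independent B"
  shows "card (span B) = CARD('a) ^ card B"
  using assms
proof (induction B rule: finite_induct)
  case (insert b B)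
  then have ind: "independent B" and b: "b \<notin> span B"
    by (auto simp: independent_insert split: if_splits)
  have "inj_on (\<lambda>(k, v). sc k b + v) (UNIV \<times> span B)"
  proof (rule inj_onI, clarsimp)
    fix k v k' v'
    assume v: "v \<in> span B" "v' \<in> span B" and eq: "sc k b + v = sc k' b + v'"
    from eq have "sc (k - k') b = v' - v"
      by (simp add: scale_left_diff_distrib algebra_simps)
    then have "sc (k - k') b \<in> span B"
      using v by (simp add: span_diff)
    then have "k = k'"
      using b span_scale[of "sc (k - k') b" B "inverse (k - k')"] by (cases "k = k'") auto
    with eq show "k = k' \<and> v = v'"
      by simp
  qed
  then have "card (span (insert b B)) = card ((UNIV :: 'a set) \<times> span B)"
    unfolding span_insert_image by (rule card_image)
  with insert ind show ?case
    by (simp add: card_cartesian_product)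
qed simp

lemma card_subspace:
  assumes "subspace x" "finite x"
  shows "card x = CARD('a) ^ dim x"
proof -
  obtain B where B: "B \<subseteq> x" "independent B" "x \<subseteq> span B" "card B = dim x"
    using basis_exists by blast
  moreover have "span B = x"
    using B assms by (metis span_minimal subset_antisym)
  ultimately show ?thesis
    using card_span_independent[of B] assms by (metis finite_subset)
qed

lemma CARD_ge2: "2 \<le> CARD('a)"
proof -
  have "card {0, 1 :: 'a} \<le> CARD('a)"
    by (rule card_mono) auto
  then show ?thesis by simp
qed

section \<open>Sums of subspaces and the dimension formula\<close>

lemma subspace_ssum: "subspace x \<Longrightarrow> subspace y \<Longrightarrow> subspace (ssum x y)"
  unfolding ssum_def by (rule subspace_sums)

lemma ssum_upper1: "subspace y \<Longrightarrow> x \<subseteq> ssum x y"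
  unfolding ssum_def using subspace_0 by force

lemma ssum_upper2: "subspace x \<Longrightarrow> y \<subseteq> ssum x y"
  unfolding ssum_def using subspace_0 by force

lemma ssum_least: "subspace z \<Longrightarrow> x \<subseteq> z \<Longrightarrow> y \<subseteq> z \<Longrightarrow> ssum x y \<subseteq> z"
  unfolding ssum_def using subspace_add by blast

lemma finite_ssum: "finite x \<Longrightarrow> finite y \<Longrightarrow> finite (ssum x y)"
  unfolding ssum_def by (simp add: finite_image_set2)

text \<open>Addition maps \<open>x \<times> y\<close> onto the sum, and the fibre over
  \<open>a + b\<close> consists of the pairs \<open>(a + t, b - t)\<close> with \<open>t\<close> in
  the intersection.\<close>

lemma card_ssum:
  assumes "subspace x" "subspace y" "finite x" "finite y"
  shows "card (ssum x y) * card (x \<inter> y) = card x * card y"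
proof -
  define f where "f = (\<lambda>(a :: 'v, b). a + b)"
  have fim: "f ` (x \<times> y) = ssum x y"
    by (auto simp: f_def ssum_def)
  have fibre: "card {p \<in> x \<times> y. f p = s} = card (x \<inter> y)" if s: "s \<in> ssum x y" for s
  proof -
    obtain a b where ab: "a \<in> x" "b \<in> y" "s = a + b"
      using s by (auto simp: ssum_def)
    have "bij_betw (\<lambda>t. (a + t, b - t)) (x \<inter> y) {p \<in> x \<times> y. f p = s}"
    proof (rule bij_betw_byWitness[where f' = "\<lambda>p. fst p - a"])
      show "(\<lambda>p. fst p - a) ` {p \<in> x \<times> y. f p = s} \<subseteq> x \<inter> y"
      proof (rule image_subsetI)
        fix p assume p: "p \<in> {p \<in> x \<times> y. f p = s}"
        obtain c d where [simp]: "p = (c, d)"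
          by (cases p)
        have cd: "c \<in> x" "d \<in> y" "f (c, d) = s"
          using p by auto
        then have "c - a = b - d"
          using ab by (simp add: f_def algebra_simps)
        moreover have "c - a \<in> x" "b - d \<in> y"
          using ab cd assms subspace_diff by auto
        ultimately show "fst p - a \<in> x \<inter> y"
          by simp
      qed
    qed (use ab assms in \<open>auto simp: f_def subspace_add subspace_diff algebra_simps\<close>)
    then show ?thesis
      by (rule bij_betw_same_card[symmetric])
  qed
  have "card (x \<times> y) = (\<Sum>s\<in>f ` (x \<times> y). card {p \<in> x \<times> y. f p = s})"
    using assms sum.image_gen[of "x \<times> y" "\<lambda>_. 1::nat" f] by simp
  also have "\<dots> = card (ssum x y) * card (x \<inter> y)"
    unfolding fim by (simp add: fibre)
  finally show ?thesis
    by (simp add: card_cartesian_product)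
qed

text \<open>All cardinalities in \<open>card_ssum\<close> are powers of the field size, so comparing
  exponents suffices.\<close>

lemma dim_ssum:
  assumes "subspace x" "subspace y" "finite x" "finite y"
  shows "dim (ssum x y) + dim (x \<inter> y) = dim x + dim y"
proof -
  have "CARD('a) ^ (dim (ssum x y) + dim (x \<inter> y)) = CARD('a) ^ (dim x + dim y)"
    using card_ssum[OF assms] assms
    by (simp add: card_subspace power_add subspace_ssum finite_ssum subspace_inter)
  then show ?thesis
    using CARD_ge2 by simp
qed

lemma dim_mono:
  assumes "subspace x" "subspace y" "finite y" "x \<subseteq> y"
  shows "dim x \<le> dim y"
proof -
  have "CARD('a) ^ dim x \<le> CARD('a) ^ dim y"
    using assms card_mono[OF assms(3,4)] by (simp add: card_subspace finite_subset)
  then show ?thesis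
    using CARD_ge2 by simp
qed

lemma subspace_dim_eq:
  assumes "subspace x" "subspace y" "finite y" "x \<subseteq> y" "dim y \<le> dim x"
  shows "x = y"
proof -
  have "dim x = dim y"
    using dim_mono assms by (simp add: le_antisym)
  then have "card x = card y"
    using assms by (simp add: card_subspace finite_subset)
  then show ?thesis
    using assms card_subset_eq by metis
qed

lemma card_covby:
  assumes "subspace x" "finite x" "subspace y" "covby sc y x"
  shows "card x = CARD('a) * card y"
proof -
  have "y \<subseteq> x" "dim x = Suc (dim y)"
    using assms by (auto simp: covby_def)
  then show ?thesis
    using assms by (simp add: card_subspace finite_subset)
qed

section \<open>Counting covers and hyperplanes\<close>

lemma covby_adjoin:
  assumes "subspace x" "finite x" "u \<notin> x"
  shows "covby sc x (ssum x (span {u}))"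
proof -
  have "x \<inter> span {u} \<subseteq> {0}"
  proof clarify
    fix v assume v: "v \<in> x" "v \<in> span {u}"
    then obtain k where k: "v = sc k u"
      by (auto simp: span_singleton)
    then have "k = 0"
      using v assms subspace_scale[of x v "inverse k"] by (cases "k = 0") auto
    with k show "v = 0" by simp
  qed
  then have "x \<inter> span {u} = {0}"
    using assms subspace_0 span_0 by auto
  moreover have "dim {0} = 0"
    using dim_span[of "{}"] dim_eq_card_independent[of "{}"] by (simp add: independent_empty)
  moreover have "dim (span {u}) = 1"
    using assms subspace_0 by (subst dim_span, subst dim_eq_card_independent) auto
  ultimately show ?thesis
    using dim_ssum[of x "span {u}"] assms finite_span[of "{u}"] ssum_upper1[of "span {u}" x]
    by (simp add: covby_def)
qed

text \<open>The sets \<open>y - x\<close>, for the covers \<open>y\<close> of \<open>x\<close>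
  inside \<open>W\<close>, partition \<open>W - x\<close>: a vector \<open>u\<close> outside
  \<open>x\<close> lies in the cover \<open>x + span {u}\<close> and in no other. Each part has
  \<open>(CARD('a) - 1) * card x\<close> elements.\<close>

lemma card_covers_within:
  assumes x: "subspace x" and W: "subspace W" "finite W" "x \<subseteq> W"
  shows "card {y. subspace y \<and> covby sc x y \<and> y \<subseteq> W} * ((CARD('a) - 1) * card x) + card x = card W"
proof -
  let ?Y = "{y. subspace y \<and> covby sc x y \<and> y \<subseteq> W}"
  have fx: "finite x"
    using W finite_subset by blast
  have fy: "finite y" if "y \<in> ?Y" for y
    using that W finite_subset by blast
  have finY: "finite ?Y"
    by (rule finite_subset[of _ "Pow W"]) (use W in auto)
  \<comment> \<open>A common vector outside \<open>x\<close> makes \<open>y \<inter> z\<close>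
    strictly larger than \<open>x\<close>, so its dimension already reaches that of \<open>y\<close>
    and of \<open>z\<close>.\<close>
  have disj: "(y - x) \<inter> (z - x) = {}" if yz: "y \<in> ?Y" "z \<in> ?Y" "y \<noteq> z" for y z
  proof (rule ccontr)
    assume "(y - x) \<inter> (z - x) \<noteq> {}"
    then obtain u where u: "u \<in> y" "u \<in> z" "u \<notin> x"
      by auto
    have "dim x < dim (y \<inter> z)"
    proof (rule ccontr)
      assume "\<not> ?thesis"
      then have "x = y \<inter> z"
        using yz x fy by (intro subspace_dim_eq) (auto simp: covby_def subspace_inter)
      with u show False by auto
    qed
    then have "dim y \<le> dim (y \<inter> z)" "dim z \<le> dim (y \<inter> z)"
      using yz by (auto simp: covby_def)
    then have "y \<inter> z = y" "y \<inter> z = z"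
      using yz fy subspace_dim_eq[of "y \<inter> z" y] subspace_dim_eq[of "y \<inter> z" z]
      by (blast intro: subspace_inter)+
    with yz show False by auto
  qed
  have "(\<Union>y\<in>?Y. y - x) = W - x"
  proof (intro subset_antisym subsetI)
    fix u assume u: "u \<in> W - x"
    then have "span {u} \<subseteq> W"
      using W by (intro span_minimal) auto
    then have "ssum x (span {u}) \<in> ?Y"
      using u x W covby_adjoin[OF x fx, of u] by (simp add: subspace_ssum ssum_least)
    moreover have "u \<in> ssum x (span {u})"
      using ssum_upper2[OF x, of "span {u}"] span_base[of u "{u}"] by auto
    ultimately show "u \<in> (\<Union>y\<in>?Y. y - x)"
      using u by blast
  qed auto
  moreover have "card (\<Union>y\<in>?Y. y - x) = (\<Sum>y\<in>?Y. card (y - x))"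
    using finY fy disj by (intro card_UN_disjoint) auto
  moreover have "card (y - x) = (CARD('a) - 1) * card x" if y: "y \<in> ?Y" for y
  proof -
    have "card y = CARD('a) * card x"
      using y fy x by (intro card_covby) auto
    then show ?thesis
      using y fx by (simp add: card_Diff_subset covby_def diff_mult_distrib)
  qed
  ultimately have "card (W - x) = card ?Y * ((CARD('a) - 1) * card x)"
    by simp
  moreover have "card (W - x) = card W - card x" "card x \<le> card W"
    using W fx by (auto simp: card_Diff_subset card_mono)
  ultimately show ?thesis
    by linarith
qed

text \<open>Double counting the pairs \<open>(y, u)\<close> with \<open>u \<in> x - y\<close> reduces the count for \<open>A\<close> to the one for
  a one-dimensional extension of \<open>A\<close>, as long as \<open>A\<close> itself is not a hyperplane.\<close>

lemma card_hyperplanes_above: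
  assumes "subspace A" "subspace x" "finite x" "A \<subseteq> x"
  shows "card {y. subspace y \<and> covby sc y x \<and> A \<subseteq> y} * ((CARD('a) - 1) * card A) + card A = card x"
  using assms
proof (induction "dim x - dim A" arbitrary: A rule: less_induct)
  case less
  let ?H = "\<lambda>A. {y. subspace y \<and> covby sc y x \<and> A \<subseteq> y}"
  have fA: "finite A"
    using less.prems finite_subset by blast
  have finH: "finite (?H B)" for B
    by (rule finite_subset[of _ "Pow x"]) (use less.prems in \<open>auto simp: covby_def\<close>)
  have fy: "finite y" "y \<subseteq> x" "subspace y" "covby sc y x" if "y \<in> ?H B" for y B
    using that less.prems finite_subset by (auto simp: covby_def)
  have dA: "dim A \<le> dim x"
    using less.prems by (intro dim_mono)
  consider "dim x = dim A" | "dim x = dim A + 1" | "dim A + 2 \<le> dim x"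
    using dA by linarith
  then show ?case
  proof cases
    case 1
    then have "A = x"
      using less.prems by (intro subspace_dim_eq) auto
    moreover have H: "?H x = {}"
      by (auto simp: covby_def)
    ultimately show ?thesis
      by (simp only: H) simp
  next
    case 2
    have "?H A = {A}"
    proof (intro subset_antisym subsetI)
      fix y assume y: "y \<in> ?H A"
      then have "A = y"
        using 2 less.prems fy[OF y] by (intro subspace_dim_eq) (auto simp: covby_def)
      then show "y \<in> {A}" by simp
    qed (use 2 less.prems in \<open>auto simp: covby_def\<close>)
    moreover have "card x = CARD('a) * card A"
      using 2 less.prems by (intro card_covby) (auto simp: covby_def)
    ultimately show ?thesis
      using CARD_ge2 by (simp add: diff_mult_distrib)
  next
    case 3
    \<comment> \<open>\<open>n\<close> is the common size of all hyperplanes of \<open>x\<close>;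
      working over the reals allows division by the field size.\<close>
    define h m n where "h = real (card (?H A))" and "m = real (card A)" and "n = real (card x) / CARD('a)"
    define Q where "Q = real CARD('a)"
    have Q: "Q \<ge> 2"
      using CARD_ge2 by (simp add: Q_def)
    have Q1: "real (CARD('a) - 1) = Q - 1"
      using CARD_ge2 by (simp add: Q_def of_nat_diff)
    have m: "m > 0"
      using less.prems fA by (auto simp: m_def card_gt_0_iff dest: subspace_0)
    have cx: "real (card x) = Q * n"
      using Q by (simp add: n_def Q_def)
    have "m < n"
    proof -
      have "CARD('a) ^ (dim A + 1) < CARD('a) ^ dim x"
        using 3 CARD_ge2 by (intro power_strict_increasing) auto
      then have "CARD('a) * card A < card x"
        using less.prems fA by (simp add: card_subspace)
      then have "Q * m < Q * n"
        unfolding cx[symmetric] by (simp add: Q_def m_def flip: of_nat_mult)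
      then show ?thesis
        using Q by simp
    qed
    \<comment> \<open>Subtract from all hyperplanes above \<open>A\<close> those containing
      \<open>u\<close>. The latter are the hyperplanes above \<open>A + span {u}\<close>, counted by
      the induction hypothesis.\<close>
    have ext: "real (card {y \<in> ?H A. u \<notin> y}) = h - (n - m) / ((Q - 1) * m)" if u: "u \<in> x - A" for u
    proof -
      let ?A = "ssum A (span {u})"
      have sub: "?A \<subseteq> y \<longleftrightarrow> A \<subseteq> y \<and> u \<in> y" if "subspace y" for y
        using that ssum_upper1[of "span {u}" A] ssum_upper2[of A "span {u}"] less.prems
          span_base[of u "{u}"] span_minimal[of "{u}" y] ssum_least[of y A "span {u}"] by auto
      have cov: "covby sc A ?A"
        using less.prems fA u by (intro covby_adjoin) auto
      have sA: "subspace ?A" "?A \<subseteq> x"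
        using less.prems u sub by (auto simp: subspace_ssum)
      have "dim x - dim ?A < dim x - dim A"
        using cov 3 by (auto simp: covby_def)
      then have "card (?H ?A) * ((CARD('a) - 1) * card ?A) + card ?A = card x"
        using less.prems sA by (intro less.hyps)
      moreover have "card ?A = CARD('a) * card A"
        using cov sA less.prems finite_subset by (intro card_covby) auto
      ultimately have "real (card (?H ?A) * ((CARD('a) - 1) * (CARD('a) * card A)) + CARD('a) * card A) = Q * n"
        by (simp add: cx)
      then have "Q * (real (card (?H ?A)) * ((Q - 1) * m) + m) = Q * n"
        unfolding of_nat_add of_nat_mult Q1 by (simp add: Q_def m_def algebra_simps)
      then have "real (card (?H ?A)) * ((Q - 1) * m) + m = n"
        using Q by (subst (asm) mult_left_cancel) auto
      then have "real (card (?H ?A)) = (n - m) / ((Q - 1) * m)"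
        using Q m by (simp add: field_simps)
      moreover have "?H A = ?H ?A \<union> {y \<in> ?H A. u \<notin> y}" "?H ?A \<inter> {y \<in> ?H A. u \<notin> y} = {}"
        using sub by auto
      then have "card (?H A) = card (?H ?A) + card {y \<in> ?H A. u \<notin> y}"
        using finH by (metis (no_types, lifting) card_Un_disjoint finite_Un)
      ultimately show ?thesis
        by (simp add: h_def)
    qed
    have hyp: "real (card {u \<in> x - A. u \<notin> y}) = (Q - 1) * n" if y: "y \<in> ?H A" for y
    proof -
      have "{u \<in> x - A. u \<notin> y} = x - y"
        using y by auto
      moreover have "card x = CARD('a) * card y"
        using fy[OF y] less.prems by (intro card_covby) auto
      moreover have "card (x - y) = card x - card y" "card y \<le> card x"
        using fy[OF y] less.prems by (auto simp: card_Diff_subset card_mono)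
      ultimately show ?thesis
        using Q by (simp add: n_def Q_def field_simps of_nat_diff)
    qed
    have "(\<Sum>u\<in>x - A. real (card {y \<in> ?H A. u \<notin> y})) = (\<Sum>y\<in>?H A. real (card {u \<in> x - A. u \<notin> y}))"
      using sum.swap[of "\<lambda>u y. of_bool (u \<notin> y) :: real" "?H A" "x - A"] finH less.prems
      by (simp add: of_bool_def sum.If_cases Int_def)
    moreover have "(\<Sum>u\<in>x - A. real (card {y \<in> ?H A. u \<notin> y})) =
        real (card (x - A)) * (h - (n - m) / ((Q - 1) * m))"
      by (subst sum.cong[OF refl ext]) auto
    moreover have "(\<Sum>y\<in>?H A. real (card {u \<in> x - A. u \<notin> y})) = h * ((Q - 1) * n)"
      by (subst sum.cong[OF refl hyp]) (auto simp: h_def)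
    moreover have "real (card (x - A)) = Q * n - m"
      using less.prems fA by (simp add: card_Diff_subset card_mono of_nat_diff m_def cx)
    ultimately have "(Q * n - m) * (h - (n - m) / ((Q - 1) * m)) = h * ((Q - 1) * n)"
      by simp
    \<comment> \<open>When \<open>A\<close> is itself a hyperplane, \<open>n = m\<close> and this
      equation is void, which is why that case is treated separately above.\<close>
    then have "(n - m) * (h * ((Q - 1) * m) + m - Q * n) = 0"
      using Q m by (simp add: field_simps)
    then have "h * ((Q - 1) * m) + m = Q * n"
      using \<open>m < n\<close> by simp
    then have "real (card (?H A) * ((CARD('a) - 1) * card A) + card A) = real (card x)"
      unfolding of_nat_add of_nat_mult Q1 by (simp add: h_def m_def cx)
    then show ?thesis
      by (simp only: of_nat_eq_iff)
  qed
qed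

end

section \<open>Subspaces relative to a fixed subspace\<close>

locale split_space = finite_field_space sc
  for sc :: "'a::{field,finite} \<Rightarrow> 'v::ab_group_add \<Rightarrow> 'v" +
  fixes Om x0 x1 :: "'v set"
  assumes subspace_Om: "subspace Om" and finite_Om: "finite Om"
    and subspace_x0: "subspace x0" and x0_le: "x0 \<subseteq> Om"
    and subspace_x1: "subspace x1"
    and sum_eq: "ssum x0 x1 = Om" and inter_eq: "x0 \<inter> x1 = {0}"
begin

abbreviation L :: "'v set set" where
  "L \<equiv> subspaces sc Om"

definition idim :: "'v set \<Rightarrow> nat" where
  "idim x = dim (x \<inter> x0)"

lemma L_iff: "x \<in> L \<longleftrightarrow> subspace x \<and> x \<subseteq> Om"
  by (simp add: subspaces_def)

lemma finite_L: "finite L"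
  by (rule finite_subset[of _ "Pow Om"]) (use finite_Om in \<open>auto simp: L_iff\<close>)

lemma in_L: "x \<in> L \<Longrightarrow> subspace x" "x \<in> L \<Longrightarrow> finite x" "x \<in> L \<Longrightarrow> x \<subseteq> Om"
  using finite_Om finite_subset by (auto simp: L_iff)

lemma L_closed:
  "x0 \<in> L" "Om \<in> L" "x \<in> L \<Longrightarrow> y \<in> L \<Longrightarrow> x \<inter> y \<in> L" "x \<in> L \<Longrightarrow> y \<in> L \<Longrightarrow> ssum x y \<in> L"
  using subspace_x0 x0_le subspace_Om
  by (auto simp: L_iff subspace_inter subspace_ssum dest: ssum_least[of Om, THEN subsetD])

lemma dim_ssum_L: "x \<in> L \<Longrightarrow> y \<in> L \<Longrightarrow> dim (ssum x y) + dim (x \<inter> y) = dim x + dim y"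
  by (simp add: dim_ssum in_L)

text \<open>This eliminates the dimension of \<open>x + x0\<close>, leaving \<open>dim\<close> and
  \<open>idim\<close> as the only invariants of a subspace.\<close>

lemma dim_ssum_x0: "x \<in> L \<Longrightarrow> dim (ssum x x0) + idim x = dim x + dim x0"
  by (simp add: dim_ssum_L L_closed idim_def)

lemma dim_mono_L: "x \<in> L \<Longrightarrow> y \<in> L \<Longrightarrow> x \<subseteq> y \<Longrightarrow> dim x \<le> dim y"
  by (simp add: dim_mono in_L)

lemma dim_eq_L: "x \<in> L \<Longrightarrow> y \<in> L \<Longrightarrow> x \<subseteq> y \<Longrightarrow> dim y \<le> dim x \<Longrightarrow> x = y"
  by (rule subspace_dim_eq) (auto simp: in_L)

lemma ssum_mono: "x \<subseteq> y \<Longrightarrow> ssum x z \<subseteq> ssum y z"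
  by (auto simp: ssum_def)

text \<open>The second inequality is monotonicity of the dimension of \<open>x + x0\<close> in
  disguise. For a subspace of codimension one the two together say that \<open>idim\<close> drops by
  0 or 1.\<close>

lemma idim_mono:
  assumes "y \<in> L" "x \<in> L" "y \<subseteq> x"
  shows "idim y \<le> idim x" "dim y + idim x \<le> dim x + idim y"
proof -
  show "idim y \<le> idim x"
    unfolding idim_def using assms by (intro dim_mono_L) (auto intro: L_closed)
  have "dim (ssum y x0) \<le> dim (ssum x x0)"
    using assms by (intro dim_mono_L ssum_mono) (auto intro: L_closed)
  then show "dim y + idim x \<le> dim x + idim y"
    using dim_ssum_x0[OF assms(1)] dim_ssum_x0[OF assms(2)] by linarith
qed

lemma inter_x0_eq_iff:
  assumes "y \<in> L" "x \<in> L" "y \<subseteq> x"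
  shows "y \<inter> x0 = x \<inter> x0 \<longleftrightarrow> idim y = idim x"
proof -
  have "y \<inter> x0 \<subseteq> x \<inter> x0"
    using assms by auto
  then show ?thesis
    using assms dim_eq_L[of "y \<inter> x0" "x \<inter> x0"] by (auto simp: idim_def L_closed)
qed

lemma ssum_x0_eq_iff:
  assumes "y \<in> L" "x \<in> L" "y \<subseteq> x"
  shows "ssum y x0 = ssum x x0 \<longleftrightarrow> dim y + idim x = dim x + idim y"
proof -
  have "ssum y x0 = ssum x x0 \<longleftrightarrow> dim (ssum y x0) = dim (ssum x x0)"
    using assms dim_eq_L[of "ssum y x0" "ssum x x0"] ssum_mono[of y x x0] by (auto simp: L_closed)
  then show ?thesis
    using dim_ssum_x0[OF assms(1)] dim_ssum_x0[OF assms(2)] by linarith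
qed

lemma ssum_upper_L: "x \<in> L \<Longrightarrow> y \<in> L \<Longrightarrow> x \<subseteq> ssum x y" "x \<in> L \<Longrightarrow> y \<in> L \<Longrightarrow> y \<subseteq> ssum x y"
  by (simp_all add: ssum_upper1 ssum_upper2 in_L)

lemma ssum_least_L: "z \<in> L \<Longrightarrow> x \<subseteq> z \<Longrightarrow> y \<subseteq> z \<Longrightarrow> ssum x y \<subseteq> z"
  by (simp add: ssum_least in_L)

text \<open>Only an inequality holds: \<open>(x \<inter> x0) + (y \<inter> x0)\<close> lies in
  \<open>(x + y) \<inter> x0\<close> but may be smaller. The gap in it is what separates
  \<open>D3\<close> from the products of lowering and raising operators.\<close>

lemma idim_submodular:
  assumes "x \<in> L" "y \<in> L"
  shows "idim x + idim y \<le> idim (ssum x y) + idim (x \<inter> y)"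
proof -
  have "ssum (x \<inter> x0) (y \<inter> x0) \<subseteq> ssum x y \<inter> x0"
    using assms ssum_upper_L[OF assms] by (intro ssum_least_L) (auto intro: L_closed)
  then have "dim (ssum (x \<inter> x0) (y \<inter> x0)) \<le> idim (ssum x y)"
    unfolding idim_def using assms by (intro dim_mono_L) (auto intro: L_closed)
  moreover have "(x \<inter> x0) \<inter> (y \<inter> x0) = (x \<inter> y) \<inter> x0"
    by auto
  ultimately show ?thesis
    using dim_ssum_L[of "x \<inter> x0" "y \<inter> x0"] assms by (simp add: L_closed idim_def)
qed

text \<open>Without an inclusion between \<open>x\<close> and \<open>y\<close> the comparison passes
  through \<open>x \<inter> y\<close>, which is contained in both. The next lemma does the same
  through \<open>x + y\<close>.\<close>

lemma inter_x0_eq_iff':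
  assumes "y \<in> L" "x \<in> L"
  shows "y \<inter> x0 = x \<inter> x0 \<longleftrightarrow> idim (x \<inter> y) = idim x \<and> idim (x \<inter> y) = idim y"
  using inter_x0_eq_iff[of "x \<inter> y" x] inter_x0_eq_iff[of "x \<inter> y" y] assms
  by (auto simp: L_closed)

lemma ssum_x0_eq_iff':
  assumes "y \<in> L" "x \<in> L"
  shows "ssum y x0 = ssum x x0 \<longleftrightarrow> dim x + idim (ssum x y) = dim (ssum x y) + idim x \<and>
    dim y + idim (ssum x y) = dim (ssum x y) + idim y" (is "?A \<longleftrightarrow> _")
proof -
  have "?A \<longleftrightarrow> ssum x x0 = ssum (ssum x y) x0 \<and> ssum y x0 = ssum (ssum x y) x0"
  proof
    assume A: ?A
    have "ssum x y \<subseteq> ssum x x0"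
      using A assms ssum_upper_L[of x x0] ssum_upper_L[of y x0] L_closed(1)
      by (intro ssum_least_L) (simp_all add: L_closed)
    then have "ssum (ssum x y) x0 \<subseteq> ssum x x0"
      using assms ssum_upper_L[of x x0] L_closed(1) by (intro ssum_least_L[of _ "ssum x y"]) (simp_all add: L_closed)
    moreover have "ssum x x0 \<subseteq> ssum (ssum x y) x0"
      using assms ssum_upper_L by (intro ssum_mono)
    ultimately show "ssum x x0 = ssum (ssum x y) x0 \<and> ssum y x0 = ssum (ssum x y) x0"
      using A by auto
  qed simp
  then show ?thesis
    using ssum_x0_eq_iff[of x "ssum x y"] ssum_x0_eq_iff[of y "ssum x y"] assms ssum_upper_L[OF assms(2,1)]
    by (simp add: L_closed)
qed

section \<open>Matrix entries in terms of dimensions\<close>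

text \<open>The parameter is the drop of \<open>idim\<close>: 0 encodes \<open>L1\<close> and 1
  encodes \<open>L2\<close>. With the transpose \<open>raise\<close> it covers all four operators,
  so each product lemma is proved once.\<close>

definition lower :: "nat \<Rightarrow> 'v op" where
  "lower a y x = of_bool (y \<subseteq> x \<and> dim x = dim y + 1 \<and> idim x = idim y + a)"

abbreviation raise :: "nat \<Rightarrow> 'v op" where
  "raise a y x \<equiv> lower a x y"

lemma L1op_eq: "y \<in> L \<Longrightarrow> x \<in> L \<Longrightarrow> L1op sc x0 y x = lower 0 y x"
  using inter_x0_eq_iff[of y x] by (auto simp: L1op_def covby_def lower_def)

lemma L2op_eq: "y \<in> L \<Longrightarrow> x \<in> L \<Longrightarrow> L2op sc x0 y x = lower 1 y x"
  using ssum_x0_eq_iff[of y x] by (auto simp: L2op_def covby_def lower_def)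

lemma R1op_eq: "y \<in> L \<Longrightarrow> x \<in> L \<Longrightarrow> R1op sc x0 y x = raise 0 y x"
  using inter_x0_eq_iff[of x y] by (auto simp: R1op_def covby_def lower_def)

lemma R2op_eq: "y \<in> L \<Longrightarrow> x \<in> L \<Longrightarrow> R2op sc x0 y x = raise 1 y x"
  using ssum_x0_eq_iff[of x y] by (auto simp: R2op_def covby_def lower_def)

lemmas LR_eq = L1op_eq L2op_eq R1op_eq R2op_eq

text \<open>The projection along \<open>x1\<close> is additive and fixes \<open>x0\<close>. In
  coordinates: the difference of the two sides lies in \<open>x0\<close> and in \<open>x1\<close>,
  hence is 0.\<close>

lemma proj0_diff:
  assumes "u \<in> Om" "v \<in> Om" "u - v \<in> x0"
  shows "proj0 x0 x1 u - proj0 x0 x1 v = u - v"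
proof -
  have proj: "proj0 x0 x1 w \<in> x0 \<and> w - proj0 x0 x1 w \<in> x1" if w: "w \<in> Om" for w
  proof -
    obtain a b where ab: "a \<in> x0" "b \<in> x1" "w = a + b"
      using w unfolding sum_eq[symmetric] ssum_def by auto
    have "c = a" if c: "c \<in> x0" "w - c \<in> x1" for c
    proof -
      have "a - c \<in> x0"
        using c ab subspace_x0 by (simp add: subspace_diff)
      moreover have "a - c = (w - c) - b"
        using ab by simp
      then have "a - c \<in> x1"
        using c ab subspace_x1 by (metis subspace_diff)
      ultimately have "a - c \<in> x0 \<inter> x1"
        by simp
      then show ?thesis
        using inter_eq by simp
    qed
    then have "\<exists>!c. c \<in> x0 \<and> w - c \<in> x1"
      using ab by (metis add_diff_cancel_left')
    then show ?thesis
      unfolding proj0_def by (rule theI')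
  qed
  let ?d = "(u - v) - (proj0 x0 x1 u - proj0 x0 x1 v)"
  have "?d \<in> x0"
    using proj assms subspace_x0 by (simp add: subspace_diff)
  moreover have "?d = (u - proj0 x0 x1 u) - (v - proj0 x0 x1 v)"
    by simp
  then have "?d \<in> x1"
    using proj assms subspace_x1 by (metis subspace_diff)
  ultimately have "?d \<in> x0 \<inter> x1"
    by simp
  then show ?thesis
    using inter_eq by simp
qed

text \<open>With \<open>proj0_diff\<close> the membership condition becomes
  \<open>w - (u - v) \<in> x \<inter> x0\<close>. The complement \<open>x1\<close> thereby
  disappears from \<open>D3\<close>.\<close>

lemma tau_img_preimage_eq:
  assumes "y \<in> L" "x \<in> L"
  shows "tau_img_preimage x0 x1 y x = ssum x y \<inter> x0"
proof (intro subset_antisym subsetI)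
  fix w assume "w \<in> tau_img_preimage x0 x1 y x"
  then obtain u v where uv: "u \<in> y" "v \<in> x" "u - v \<in> x0"
      "w - (proj0 x0 x1 u - proj0 x0 x1 v) \<in> x \<inter> x0"
    by (auto simp: tau_img_preimage_def)
  define t where "t = w - (u - v)"
  have t: "t \<in> x \<inter> x0"
    using uv proj0_diff[of u v] in_L(3)[OF assms(1)] in_L(3)[OF assms(2)] by (simp add: t_def subset_iff)
  have "w = (t - v) + u" "w = t + (u - v)"
    by (simp_all add: t_def)
  moreover have "t - v \<in> x" "t + (u - v) \<in> x0"
    using t uv assms subspace_x0 in_L(1) by (auto intro: subspace_diff subspace_add)
  ultimately have "w \<in> ssum x y" "w \<in> x0"
    using uv(1) unfolding ssum_def by (blast, metis)
  then show "w \<in> ssum x y \<inter> x0"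
    by simp
next
  fix w assume "w \<in> ssum x y \<inter> x0"
  then obtain v u where w: "w = v + u" "v \<in> x" "u \<in> y" "w \<in> x0"
    by (auto simp: ssum_def)
  \<comment> \<open>The definition uses differences \<open>u - v\<close> while the sum gives
    \<open>v + u\<close>, so the witness from \<open>x\<close> is \<open>- v\<close>.\<close>
  have v: "- v \<in> x"
    using w assms in_L(1) subspace_neg by blast
  have "u - (- v) = w"
    using w by (simp add: add.commute)
  then have "proj0 x0 x1 u - proj0 x0 x1 (- v) = w"
    using proj0_diff[of u "- v"] w v in_L(3)[OF assms(1)] in_L(3)[OF assms(2)]
    by (simp add: subset_iff add.commute)
  then have "w - (proj0 x0 x1 u - proj0 x0 x1 (- v)) \<in> x \<inter> x0"
    using assms in_L(1) subspace_x0 subspace_0 by simp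
  moreover have "u - (- v) \<in> x0"
    using w(4) by (simp only: \<open>u - (- v) = w\<close>)
  ultimately show "w \<in> tau_img_preimage x0 x1 y x"
    unfolding tau_img_preimage_def using w(3) v by blast
qed

text \<open>The rank is \<open>idim (ssum x y) - idim x\<close>; equality of the sums with
  \<open>x0\<close> forces \<open>dim (ssum x y) - dim x\<close> to be the same number.\<close>

lemma D3op_eq:
  assumes "y \<in> L" "x \<in> L"
  shows "D3op sc x0 x1 y x = of_bool (idim (x \<inter> y) = idim x \<and> idim y = idim x \<and>
    dim y = dim x \<and> dim (ssum x y) = dim x + 1 \<and> idim (ssum x y) = idim x + 1)"
  using inter_x0_eq_iff'[OF assms] ssum_x0_eq_iff'[OF assms]
  unfolding D3op_def tau_rank_diff_def tau_img_preimage_eq[OF assms] idim_def[symmetric]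
  by auto

lemma D4op_eq:
  assumes "x \<in> L"
  shows "D4op x0 y x = (if y = x then of_nat (card x) / of_nat (CARD('a) ^ idim x) + of_nat (card x0) / of_nat (CARD('a) ^ idim x) - 1 else 0)"
proof -
  have "card (x \<inter> x0) = CARD('a) ^ idim x"
    unfolding idim_def using assms by (intro card_subspace in_L) (auto intro: L_closed)
  then show ?thesis
    by (simp add: D4op_def add_divide_distrib)
qed

section \<open>Products of lowering and raising operators off the diagonal\<close>

text \<open>These linear constraints are everything that is needed about the position of
  \<open>x\<close> and \<open>z\<close> relative to \<open>x0\<close>; the later comparisons of
  entries follow from them by linear arithmetic.\<close>

lemma dim_pair:
  assumes "x \<in> L" "z \<in> L"
  shows "dim (ssum x z) + dim (x \<inter> z) = dim x + dim z"
    "idim x \<le> idim (ssum x z)" "dim x + idim (ssum x z) \<le> dim (ssum x z) + idim x"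
    "idim z \<le> idim (ssum x z)" "dim z + idim (ssum x z) \<le> dim (ssum x z) + idim z"
    "idim (x \<inter> z) \<le> idim x" "dim (x \<inter> z) + idim x \<le> dim x + idim (x \<inter> z)"
    "idim (x \<inter> z) \<le> idim z" "dim (x \<inter> z) + idim z \<le> dim z + idim (x \<inter> z)"
    "idim x + idim z \<le> idim (ssum x z) + idim (x \<inter> z)"
  using idim_mono[OF assms(1) L_closed(4) ssum_upper_L(1)] idim_mono[OF assms(2) L_closed(4) ssum_upper_L(2)]
    idim_mono[OF L_closed(3) assms(1) Int_lower1] idim_mono[OF L_closed(3) assms(2) Int_lower2]
    dim_ssum_L idim_submodular assms
  by blast+

text \<open>Distinct \<open>x\<close> and \<open>z\<close> of equal dimension have a sum strictly
  larger than either, so a common cover has no room beyond it. Dually, a common hyperplane must be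
  the intersection.\<close>

lemma upper_bound_eq_ssum:
  assumes "x \<in> L" "z \<in> L" "x \<noteq> z" "w \<in> L" "z \<subseteq> w" "x \<subseteq> w" "dim w = dim z + 1" "dim w = dim x + 1"
  shows "w = ssum x z"
proof -
  have s: "ssum x z \<in> L" "x \<subseteq> ssum x z" "z \<subseteq> ssum x z" "ssum x z \<subseteq> w"
    using assms ssum_upper_L[of x z] ssum_least_L[of w x z] by (simp_all add: L_closed)
  have "dim x < dim (ssum x z)"
  proof (rule ccontr)
    assume "\<not> ?thesis"
    then have "x = ssum x z" "z = ssum x z"
      using dim_eq_L[of x "ssum x z"] dim_eq_L[of z "ssum x z"] assms s by auto
    with assms show False by auto
  qed
  then show ?thesis
    using dim_eq_L[of "ssum x z" w] s assms by auto
qed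

lemma lower_bound_eq_inter:
  assumes "x \<in> L" "z \<in> L" "x \<noteq> z" "y \<in> L" "y \<subseteq> z" "y \<subseteq> x" "dim z = dim y + 1" "dim x = dim y + 1"
  shows "y = x \<inter> z"
proof -
  have s: "x \<inter> z \<in> L"
    using assms by (simp add: L_closed)
  have "dim (x \<inter> z) < dim x"
  proof (rule ccontr)
    assume "\<not> ?thesis"
    then have "x \<inter> z = x" "x \<inter> z = z"
      using dim_eq_L[of "x \<inter> z" x] dim_eq_L[of "x \<inter> z" z] assms s by auto
    with assms show False by auto
  qed
  then show ?thesis
    using dim_eq_L[of y "x \<inter> z"] s assms by auto
qed

lemma opmul_of_bool:
  assumes "\<And>z. z \<in> L \<Longrightarrow> A y z * B z x = of_bool (P z)"
  shows "opmul L A B y x = of_nat (card {z \<in> L. P z})"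
proof -
  have "opmul L A B y x = (\<Sum>z\<in>L. of_bool (P z))"
    unfolding opmul_def using assms by (intro sum.cong) auto
  then show ?thesis
    using finite_L by (simp add: of_bool_def sum.If_cases Int_def)
qed

lemma lower_raise_offdiag:
  assumes "x \<in> L" "z \<in> L" "x \<noteq> z"
  shows "opmul L (lower a) (raise b) z x = of_bool (dim x = dim z \<and> dim (ssum x z) = dim x + 1 \<and>
    idim (ssum x z) = idim z + a \<and> idim (ssum x z) = idim x + b)" (is "_ = of_bool ?C")
proof -
  have "opmul L (lower a) (raise b) z x = of_nat (card {w \<in> L. z \<subseteq> w \<and> x \<subseteq> w \<and> dim w = dim z + 1 \<and>
      dim w = dim x + 1 \<and> idim w = idim z + a \<and> idim w = idim x + b})"
    by (rule opmul_of_bool) (auto simp: lower_def)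
  also have "{w \<in> L. z \<subseteq> w \<and> x \<subseteq> w \<and> dim w = dim z + 1 \<and> dim w = dim x + 1 \<and>
      idim w = idim z + a \<and> idim w = idim x + b} = (if ?C then {ssum x z} else {})" (is "?S = ?T")
  proof (intro set_eqI iffI)
    fix w assume w: "w \<in> ?S"
    then have "w = ssum x z"
      by (intro upper_bound_eq_ssum[OF assms]) simp_all
    moreover from this have ?C
      using w by simp
    ultimately show "w \<in> ?T"
      by simp
  next
    fix w assume "w \<in> ?T"
    then have "w = ssum x z" ?C
      by (simp_all split: if_splits)
    then show "w \<in> ?S"
      using assms ssum_upper_L[of x z] by (simp add: L_closed)
  qed
  finally show ?thesis
    by (simp split: if_splits)
qed

lemma raise_lower_offdiag:
  assumes "x \<in> L" "z \<in> L" "x \<noteq> z"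
  shows "opmul L (raise a) (lower b) z x = of_bool (dim x = dim z \<and> dim x = dim (x \<inter> z) + 1 \<and>
    idim z = idim (x \<inter> z) + a \<and> idim x = idim (x \<inter> z) + b)" (is "_ = of_bool ?C")
proof -
  have "opmul L (raise a) (lower b) z x = of_nat (card {w \<in> L. w \<subseteq> z \<and> w \<subseteq> x \<and> dim z = dim w + 1 \<and>
      dim x = dim w + 1 \<and> idim z = idim w + a \<and> idim x = idim w + b})"
    by (rule opmul_of_bool) (auto simp: lower_def)
  also have "{w \<in> L. w \<subseteq> z \<and> w \<subseteq> x \<and> dim z = dim w + 1 \<and> dim x = dim w + 1 \<and>
      idim z = idim w + a \<and> idim x = idim w + b} = (if ?C then {x \<inter> z} else {})" (is "?S = ?T")
  proof (intro set_eqI iffI)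
    fix w assume w: "w \<in> ?S"
    then have "w = x \<inter> z"
      by (intro lower_bound_eq_inter[OF assms]) simp_all
    moreover from this have ?C
      using w by simp
    ultimately show "w \<in> ?T"
      by simp
  next
    fix w assume "w \<in> ?T"
    then have "w = x \<inter> z" ?C
      by (simp_all split: if_splits)
    then show "w \<in> ?S"
      using assms by (simp add: L_closed)
  qed
  finally show ?thesis
    by (simp split: if_splits)
qed

text \<open>On the diagonal every summand vanishes, as one step cannot change \<open>idim\<close> by
  both 0 and 1. Off it, either condition forces equality in the submodular inequality, so the sum
  and the intersection carry the same information.\<close>

lemma lower0_raise1:
  assumes "x \<in> L" "z \<in> L"
  shows "opmul L (lower 0) (raise 1) z x = opmul L (raise 1) (lower 0) z x"
proof (cases "x = z")
  case True
  then show ?thesis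
    unfolding opmul_def by (intro sum.cong) (auto simp: lower_def)
next
  case False
  have "(dim x = dim z \<and> dim (ssum x z) = dim x + 1 \<and>
      idim (ssum x z) = idim z + 0 \<and> idim (ssum x z) = idim x + 1) \<longleftrightarrow>
    (dim x = dim z \<and> dim x = dim (x \<inter> z) + 1 \<and> idim z = idim (x \<inter> z) + 1 \<and> idim x = idim (x \<inter> z) + 0)"
    using dim_pair[OF assms] by linarith
  then show ?thesis
    unfolding lower_raise_offdiag[OF assms False] raise_lower_offdiag[OF assms False] by simp
qed

section \<open>Diagonal entries as subspace counts\<close>

lemma covers_within_L:
  assumes "x \<in> L" "W \<in> L" "x \<subseteq> W"
  shows "(of_nat CARD('a) - 1) * of_nat (card {y \<in> L. x \<subseteq> y \<and> dim y = dim x + 1 \<and> y \<subseteq> W}) =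
    of_nat CARD('a) ^ (dim W - dim x) - (1 :: complex)"
proof -
  let ?Y = "{y. subspace y \<and> covby sc x y \<and> y \<subseteq> W}"
  have eq: "{y \<in> L. x \<subseteq> y \<and> dim y = dim x + 1 \<and> y \<subseteq> W} = ?Y"
    using assms by (auto simp: L_iff covby_def)
  have "dim x \<le> dim W"
    using assms by (rule dim_mono_L)
  then have "card W = CARD('a) ^ (dim W - dim x) * card x"
    using assms by (simp add: card_subspace in_L flip: power_add)
  with card_covers_within[of x W] have "card x * (card ?Y * (CARD('a) - 1) + 1) = card x * CARD('a) ^ (dim W - dim x)"
    using assms in_L by (simp add: algebra_simps)
  moreover have "card x \<noteq> 0"
    using assms(1) by (simp add: card_subspace in_L)
  ultimately have "card ?Y * (CARD('a) - 1) + 1 = CARD('a) ^ (dim W - dim x)"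
    by (subst (asm) mult_left_cancel)
  then have "of_nat (card ?Y * (CARD('a) - 1) + 1) = (of_nat (CARD('a) ^ (dim W - dim x)) :: complex)"
    by (simp only:)
  then show ?thesis
    unfolding eq using CARD_ge2 by (simp add: of_nat_diff algebra_simps)
qed

lemma hyperplanes_above_L:
  assumes "A \<in> L" "x \<in> L" "A \<subseteq> x"
  shows "(of_nat CARD('a) - 1) * of_nat (card {y \<in> L. y \<subseteq> x \<and> dim x = dim y + 1 \<and> A \<subseteq> y}) =
    of_nat CARD('a) ^ (dim x - dim A) - (1 :: complex)"
proof -
  let ?Y = "{y. subspace y \<and> covby sc y x \<and> A \<subseteq> y}"
  have eq: "{y \<in> L. y \<subseteq> x \<and> dim x = dim y + 1 \<and> A \<subseteq> y} = ?Y"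
    using assms by (auto simp: L_iff covby_def)
  have "dim A \<le> dim x"
    using assms by (rule dim_mono_L)
  then have "card x = CARD('a) ^ (dim x - dim A) * card A"
    using assms by (simp add: card_subspace in_L flip: power_add)
  with card_hyperplanes_above[of A x] have "card A * (card ?Y * (CARD('a) - 1) + 1) = card A * CARD('a) ^ (dim x - dim A)"
    using assms in_L by (simp add: algebra_simps)
  moreover have "card A \<noteq> 0"
    using assms(1) by (simp add: card_subspace in_L)
  ultimately have "card ?Y * (CARD('a) - 1) + 1 = CARD('a) ^ (dim x - dim A)"
    by (subst (asm) mult_left_cancel)
  then have "of_nat (card ?Y * (CARD('a) - 1) + 1) = (of_nat (CARD('a) ^ (dim x - dim A)) :: complex)"
    by (simp only:)
  then show ?thesis
    unfolding eq using CARD_ge2 by (simp add: of_nat_diff algebra_simps)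
qed

text \<open>A cover of \<open>x\<close> enlarges the intersection with \<open>x0\<close> exactly
  when it lies inside \<open>x + x0\<close>, so \<open>card_covers_within\<close> applies with that
  bound.\<close>

lemma lower1_raise1_diag:
  assumes "x \<in> L"
  shows "(of_nat CARD('a) - 1) * opmul L (lower 1) (raise 1) x x = of_nat CARD('a) ^ (dim x0 - idim x) - 1"
proof -
  have "opmul L (lower 1) (raise 1) x x =
      of_nat (card {w \<in> L. x \<subseteq> w \<and> dim w = dim x + 1 \<and> w \<subseteq> ssum x x0})"
  proof (rule opmul_of_bool)
    fix w assume w: "w \<in> L"
    have "w \<subseteq> ssum x x0 \<longleftrightarrow> idim w = idim x + 1" if xw: "x \<subseteq> w" "dim w = dim x + 1"
    proof -
      have "w \<subseteq> ssum x x0 \<longleftrightarrow> ssum x x0 = ssum w x0"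
      proof
        assume "w \<subseteq> ssum x x0"
        then have "ssum w x0 \<subseteq> ssum x x0"
          using assms ssum_upper_L(2)[OF assms L_closed(1)] by (intro ssum_least_L) (simp_all add: L_closed)
        then show "ssum x x0 = ssum w x0"
          using ssum_mono[OF xw(1)] by (rule subset_antisym[rotated])
      next
        assume "ssum x x0 = ssum w x0"
        then show "w \<subseteq> ssum x x0"
          using ssum_upper_L(1)[OF w L_closed(1)] by simp
      qed
      then show ?thesis
        using ssum_x0_eq_iff[OF assms w xw(1)] xw by auto
    qed
    then show "lower 1 x w * raise 1 w x = of_bool (x \<subseteq> w \<and> dim w = dim x + 1 \<and> w \<subseteq> ssum x x0)"
      by (auto simp: lower_def)
  qed
  moreover have "dim (ssum x x0) - dim x = dim x0 - idim x"
    using dim_ssum_x0[OF assms] by linarith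
  ultimately show ?thesis
    using covers_within_L[of x "ssum x x0"] assms ssum_upper_L[of x x0] by (simp add: L_closed)
qed

text \<open>The covers with unchanged \<open>idim\<close> are those not inside
  \<open>x + x0\<close>, a complement rather than an interval. Hence all covers are counted together
  and the other type is subtracted later; the mixed products vanish termwise.\<close>

lemma lower_raise_diag_sum:
  assumes "x \<in> L"
  shows "(of_nat CARD('a) - 1) * (opmul L (lower 0) (raise 0) x x + opmul L (lower 1) (raise 1) x x) =
    of_nat CARD('a) ^ (dim Om - dim x) - 1"
proof -
  have "opmul L (lower 0) (raise 0) x x + opmul L (lower 1) (raise 1) x x =
    opmul L (\<lambda>y x. lower 0 y x + lower 1 y x) (\<lambda>y x. raise 0 y x + raise 1 y x) x x"
    unfolding opmul_def sum.distrib[symmetric] by (intro sum.cong) (auto simp: lower_def)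
  also have "\<dots> = of_nat (card {w \<in> L. x \<subseteq> w \<and> dim w = dim x + 1 \<and> w \<subseteq> Om})"
  proof (rule opmul_of_bool)
    fix w assume w: "w \<in> L"
    have "idim w = idim x \<or> idim w = idim x + 1" if "x \<subseteq> w" "dim w = dim x + 1"
      using idim_mono[OF assms w that(1)] that(2) by linarith
    then show "(lower 0 x w + lower 1 x w) * (raise 0 w x + raise 1 w x) =
        of_bool (x \<subseteq> w \<and> dim w = dim x + 1 \<and> w \<subseteq> Om)"
      using in_L(3)[OF w] by (auto simp: lower_def)
  qed
  finally show ?thesis
    using covers_within_L[of x Om] assms in_L by (simp add: L_closed)
qed

text \<open>A hyperplane of \<open>x\<close> keeps \<open>idim\<close> exactly when it contains
  \<open>x \<inter> x0\<close>.\<close>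

lemma raise0_lower0_diag:
  assumes "x \<in> L"
  shows "(of_nat CARD('a) - 1) * opmul L (raise 0) (lower 0) x x = of_nat CARD('a) ^ (dim x - idim x) - 1"
proof -
  have "opmul L (raise 0) (lower 0) x x =
      of_nat (card {w \<in> L. w \<subseteq> x \<and> dim x = dim w + 1 \<and> x \<inter> x0 \<subseteq> w})"
  proof (rule opmul_of_bool)
    fix w assume w: "w \<in> L"
    have "x \<inter> x0 \<subseteq> w \<longleftrightarrow> idim x = idim w" if "w \<subseteq> x"
      using inter_x0_eq_iff[OF w assms that] that by auto
    then show "raise 0 x w * lower 0 w x = of_bool (w \<subseteq> x \<and> dim x = dim w + 1 \<and> x \<inter> x0 \<subseteq> w)"
      by (auto simp: lower_def)
  qed
  then show ?thesis
    using hyperplanes_above_L[of "x \<inter> x0" x] assms by (simp add: L_closed idim_def)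
qed

text \<open>Hyperplanes losing part of \<open>x \<inter> x0\<close> are again a complement, so the
  total over all hyperplanes is taken, which is the count above the zero subspace.\<close>

lemma raise_lower_diag_sum:
  assumes "x \<in> L"
  shows "(of_nat CARD('a) - 1) * (opmul L (raise 0) (lower 0) x x + opmul L (raise 1) (lower 1) x x) =
    of_nat CARD('a) ^ dim x - 1"
proof -
  have zero: "{0} \<in> L" "{0} \<subseteq> x"
    using subspace_Om assms in_L(1) by (auto simp: L_iff subspace_0 subspace_single_0)
  have "CARD('a) ^ dim {0} = 1"
    using card_subspace[of "{0}"] zero by (simp add: in_L)
  then have "dim {0} = 0"
    using CARD_ge2 by (cases "dim {0}") auto
  have "opmul L (raise 0) (lower 0) x x + opmul L (raise 1) (lower 1) x x =
    opmul L (\<lambda>y x. raise 0 y x + raise 1 y x) (\<lambda>y x. lower 0 y x + lower 1 y x) x x"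
    unfolding opmul_def sum.distrib[symmetric] by (intro sum.cong) (auto simp: lower_def)
  also have "\<dots> = of_nat (card {w \<in> L. w \<subseteq> x \<and> dim x = dim w + 1 \<and> {0} \<subseteq> w})"
  proof (rule opmul_of_bool)
    fix w assume w: "w \<in> L"
    have "idim x = idim w \<or> idim x = idim w + 1" if "w \<subseteq> x" "dim x = dim w + 1"
      using idim_mono[OF w assms that(1)] that(2) by linarith
    moreover have "{0} \<subseteq> w"
      using w in_L(1) subspace_0 by auto
    ultimately show "(raise 0 x w + raise 1 x w) * (lower 0 w x + lower 1 w x) =
        of_bool (w \<subseteq> x \<and> dim x = dim w + 1 \<and> {0} \<subseteq> w)"
      by (auto simp: lower_def)
  qed
  finally show ?thesis
    using hyperplanes_above_L[of "{0}" x] assms zero \<open>dim {0} = 0\<close> by simp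
qed

text \<open>Both sides count subspaces strictly between \<open>z\<close> and \<open>x\<close> in
  codimension two. There are \<open>CARD('a) + 1\<close> of them: a single one contains
  \<open>x \<inter> x0\<close> and serves \<open>lower 1\<close> after \<open>lower 0\<close>, the
  remaining ones serve the other order.\<close>

lemma lower0_lower1:
  assumes "x \<in> L" "z \<in> L"
  shows "opmul L (lower 0) (lower 1) z x = of_nat CARD('a) * opmul L (lower 1) (lower 0) z x"
proof -
  let ?P = "\<lambda>y. z \<subseteq> y \<and> dim y = dim z + 1 \<and> y \<subseteq> x"
  let ?A = "{y \<in> L. ?P y \<and> dim x = dim y + 1 \<and> idim y = idim z \<and> idim x = idim y + 1}"
  let ?B = "{y \<in> L. ?P y \<and> dim x = dim y + 1 \<and> idim y = idim z + 1 \<and> idim x = idim y}"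
  have prod: "opmul L (lower 0) (lower 1) z x = of_nat (card ?A)"
    "opmul L (lower 1) (lower 0) z x = of_nat (card ?B)"
    by (rule opmul_of_bool; auto simp: lower_def)+
  have "of_nat (card ?A) = of_nat CARD('a) * (of_nat (card ?B) :: complex)"
  proof (cases "z \<subseteq> x \<and> dim x = dim z + 2 \<and> idim x = idim z + 1")
    case False
    then have "?A = {}" "?B = {}"
      by auto
    then show ?thesis
      by (simp only: card.empty of_nat_0 mult_zero_right)
  next
    case True
    \<comment> \<open>Any intermediate space with full \<open>idim\<close> contains \<open>z\<close>
      and \<open>x \<inter> x0\<close>, hence this sum, which already has the right
      dimension.\<close>
    define v where "v = ssum z (x \<inter> x0)"
    have v: "v \<in> L" "z \<subseteq> v" "x \<inter> x0 \<subseteq> v" "v \<subseteq> x"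
      using assms True ssum_upper_L[of z "x \<inter> x0"] ssum_least_L[of x z "x \<inter> x0"]
      by (auto simp: v_def L_closed)
    have "z \<inter> (x \<inter> x0) = z \<inter> x0"
      using True by auto
    then have dv: "dim v = dim z + 1"
      using dim_ssum_L[of z "x \<inter> x0"] True assms by (simp add: v_def L_closed flip: idim_def)
    have iv: "idim v = idim x"
      using inter_x0_eq_iff[of v x] v assms by auto
    have uniq: "y = v" if y: "y \<in> L" "?P y" "idim y = idim x" for y
    proof -
      have "x \<inter> x0 \<subseteq> y"
        using y inter_x0_eq_iff[of y x] assms by auto
      then have "v \<subseteq> y"
        unfolding v_def using y by (intro ssum_least_L) auto
      then show ?thesis
        using y v dv dim_eq_L[of v y] by auto
    qed
    have B: "?B = {v}"
    proof (intro subset_antisym subsetI)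
      fix y assume "y \<in> ?B"
      then have "y = v"
        by (intro uniq) simp_all
      then show "y \<in> {v}" by simp
    next
      fix y assume "y \<in> {v}"
      then show "y \<in> ?B"
        using v dv iv True by simp
    qed
    have A: "?A = {y \<in> L. ?P y} - {v}"
    proof (intro subset_antisym subsetI)
      fix y assume "y \<in> ?A"
      then show "y \<in> {y \<in> L. ?P y} - {v}"
        using iv by auto
    next
      fix y assume y: "y \<in> {y \<in> L. ?P y} - {v}"
      then have "idim z \<le> idim y" "idim y \<le> idim x"
        using idim_mono(1)[of z y] idim_mono(1)[of y x] assms by simp_all
      moreover have "idim y \<noteq> idim x"
        using y uniq[of y] by auto
      ultimately show "y \<in> ?A"
        using y True by simp
    qed
    have "finite {y \<in> L. ?P y}"
      using finite_L by simp
    moreover have "v \<in> {y \<in> L. ?P y}"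
      using v dv by simp
    ultimately have "card {y \<in> L. ?P y} = Suc (card ?A)"
      unfolding A by (rule card_Suc_Diff1[symmetric])
    moreover define c k :: complex where "c = of_nat (card ?A)" and "k = of_nat CARD('a)"
    moreover have "(k - 1) * of_nat (card {y \<in> L. ?P y}) = k ^ 2 - 1"
      using covers_within_L[of z x] assms True by (simp add: k_def)
    ultimately have "(k - 1) * (c + 1) = k ^ 2 - 1"
      by (simp only: of_nat_Suc add.commute)
    then have "(k - 1) * (c - k) = 0"
      by (simp add: algebra_simps power2_eq_square)
    moreover have "k - 1 \<noteq> 0"
      using CARD_ge2 by (simp add: k_def of_nat_eq_1_iff)
    ultimately have "c = k"
      by simp
    then show ?thesis
      unfolding B c_def k_def by (simp only: card.empty card_insert_disjoint) simp
  qed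
  then show ?thesis
    by (simp only: prod)
qed

subsection \<open>The operator \<open>M\<close>\<close>

abbreviation L1 :: "'v op" where "L1 \<equiv> L1op sc x0"
abbreviation L2 :: "'v op" where "L2 \<equiv> L2op sc x0"
abbreviation R1 :: "'v op" where "R1 \<equiv> R1op sc x0"
abbreviation R2 :: "'v op" where "R2 \<equiv> R2op sc x0"
abbreviation M :: "'v op" where "M \<equiv> Mop sc x0 x1"

lemma qq_nonzero: "qq TYPE('a) \<noteq> 0"
  using CARD_ge2 by (simp add: qq_def)

lemma Mop_diag:
  assumes "x \<in> L"
  shows "M x x = of_nat CARD('a) ^ (dim x - idim x) + of_nat CARD('a) ^ (dim x0 - idim x) - 1"
proof -
  have "dim (ssum x x) = dim x"
    using dim_ssum_L[OF assms assms] by simp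
  then have "D3op sc x0 x1 x x = 0"
    using assms by (simp add: D3op_eq)
  moreover have "idim x \<le> dim x" "idim x \<le> dim x0"
    unfolding idim_def using assms by (auto intro!: dim_mono_L simp: L_closed)
  then have "of_nat (card y) / of_nat (CARD('a) ^ idim x) = (of_nat CARD('a) ^ (dim y - idim x) :: complex)"
    if "y = x \<or> y = x0" for y
    using that assms subspace_x0 in_L finite_subset[OF x0_le finite_Om]
    by (auto simp: card_subspace power_diff)
  ultimately show ?thesis
    using assms by (simp add: Mop_def opadd_def opsmult_def D4op_eq)
qed

lemma Mop_offdiag:
  assumes "z \<in> L" "x \<in> L" "x \<noteq> z"
  shows "M z x = (of_nat CARD('a) - 1) * of_bool (idim (x \<inter> z) = idim x \<and> idim z = idim x \<and>
    dim z = dim x \<and> dim (ssum x z) = dim x + 1 \<and> idim (ssum x z) = idim x + 1)"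
  using assms by (simp add: Mop_def opadd_def opsmult_def D3op_eq D4op_eq qq_sq)

text \<open>If the intersection is a common hyperplane of both with full \<open>idim\<close>, the
  sum has \<open>idim\<close> equal to that of \<open>x\<close> or one more. The first case cancels
  against \<open>lower 0\<close> after \<open>raise 0\<close>; the second is the support of
  \<open>D3\<close>.\<close>

lemma comm_lower0_raise0:
  assumes "z \<in> L" "x \<in> L"
  shows "(of_nat CARD('a) - 1) * (opmul L (lower 0) (raise 0) z x - opmul L (raise 0) (lower 0) z x) =
    (if z = x then of_nat CARD('a) ^ (dim Om - dim x) else 0) - M z x"
proof (cases "x = z")
  case True
  have "k * (a - c) = d - m" if "k * (a + b) = d - 1" "k * b = p - 1" "k * c = r - 1" "m = r + p - 1"
    for a b c d k m p r :: complex
    using that by algebra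
  from this[OF lower_raise_diag_sum lower1_raise1_diag raise0_lower0_diag Mop_diag, OF assms(2,2,2,2)]
  show ?thesis
    by (simp only: True refl if_True)
next
  case False
  let ?U = "dim x = dim z \<and> dim (ssum x z) = dim x + 1 \<and> idim (ssum x z) = idim z + 0 \<and> idim (ssum x z) = idim x + 0"
  let ?V = "dim x = dim z \<and> dim x = dim (x \<inter> z) + 1 \<and> idim z = idim (x \<inter> z) + 0 \<and> idim x = idim (x \<inter> z) + 0"
  let ?W = "idim (x \<inter> z) = idim x \<and> idim z = idim x \<and>
    dim z = dim x \<and> dim (ssum x z) = dim x + 1 \<and> idim (ssum x z) = idim x + 1"
  have of_bool_diff: "of_bool U - of_bool V = (- of_bool W :: complex)" if "V \<longleftrightarrow> U \<or> W" "\<not> (U \<and> W)" for U V W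
    using that by auto
  have "?V \<longleftrightarrow> ?U \<or> ?W" "\<not> (?U \<and> ?W)"
    using dim_pair[OF assms(2,1)] by linarith+
  then have "of_bool ?U - of_bool ?V = (- of_bool ?W :: complex)"
    by (rule of_bool_diff)
  then show ?thesis
    unfolding lower_raise_offdiag[OF assms(2,1) False] raise_lower_offdiag[OF assms(2,1) False]
      Mop_offdiag[OF assms False] using False by simp
qed

text \<open>Dual to \<open>comm_lower0_raise0\<close>: the sum now has \<open>idim x + 1\<close>,
  and the intersection either loses one from \<open>idim\<close>, which cancels, or keeps it, which
  is the support of \<open>D3\<close>.\<close>

lemma comm_lower1_raise1:
  assumes "z \<in> L" "x \<in> L"
  shows "(of_nat CARD('a) - 1) * (opmul L (lower 1) (raise 1) z x - opmul L (raise 1) (lower 1) z x) =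
    M z x - (if z = x then of_nat CARD('a) ^ dim x else 0)"
proof (cases "x = z")
  case True
  have "k * (b - e) = m - d" if "k * (c + e) = d - 1" "k * b = p - 1" "k * c = r - 1" "m = r + p - 1"
    for b c d e k m p r :: complex
    using that by algebra
  from this[OF raise_lower_diag_sum lower1_raise1_diag raise0_lower0_diag Mop_diag, OF assms(2,2,2,2)]
  show ?thesis
    by (simp only: True refl if_True)
next
  case False
  let ?U = "dim x = dim z \<and> dim (ssum x z) = dim x + 1 \<and> idim (ssum x z) = idim z + 1 \<and> idim (ssum x z) = idim x + 1"
  let ?V = "dim x = dim z \<and> dim x = dim (x \<inter> z) + 1 \<and> idim z = idim (x \<inter> z) + 1 \<and> idim x = idim (x \<inter> z) + 1"
  let ?W = "idim (x \<inter> z) = idim x \<and> idim z = idim x \<and>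
    dim z = dim x \<and> dim (ssum x z) = dim x + 1 \<and> idim (ssum x z) = idim x + 1"
  have of_bool_diff: "of_bool U - of_bool V = (of_bool W :: complex)" if "U \<longleftrightarrow> V \<or> W" "\<not> (V \<and> W)" for U V W
    using that by auto
  have "?U \<longleftrightarrow> ?V \<or> ?W" "\<not> (?V \<and> ?W)"
    using dim_pair[OF assms(2,1)] by linarith+
  then have "of_bool ?U - of_bool ?V = (of_bool ?W :: complex)"
    by (rule of_bool_diff)
  then show ?thesis
    unfolding lower_raise_offdiag[OF assms(2,1) False] raise_lower_offdiag[OF assms(2,1) False]
      Mop_offdiag[OF assms False] using False by simp
qed

text \<open>\<open>M\<close> is positive definite: it is a positive diagonal matrix plus a Gram matrix whose vectors are
  indexed by pairs of a hyperplane of \<open>x\<close> containing \<open>x \<inter> x0\<close> and the value of \<open>x + x0\<close>.\<close>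

lemma opinvertible_M: "opinvertible L M"
proof (rule opinvertible_gram[OF finite_L])
  let ?s = "\<lambda>p x. of_bool (snd p = ssum x x0 \<and> fst p \<subseteq> x \<and> dim x = dim (fst p) + 1 \<and> idim x = idim (fst p)) :: real"
  \<comment> \<open>This is what remains of the diagonal entry of \<open>M\<close> after removing
    \<open>CARD('a) - 1\<close> times the number of hyperplanes of \<open>x\<close> above
    \<open>x \<inter> x0\<close>.\<close>
  let ?c = "\<lambda>x. real CARD('a) ^ (dim x0 - idim x)"
  show "0 < ?c x" for x
    using CARD_ge2 by simp
  show "0 \<le> real CARD('a) - 1"
    using CARD_ge2 by simp
  fix z x assume zx: "z \<in> L" "x \<in> L"
  have pairs: "(\<Sum>p\<in>L \<times> L. ?s p z * ?s p x) = (\<Sum>y\<in>L. \<Sum>C\<in>L. ?s (y, C) z * ?s (y, C) x)"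
    by (simp add: sum.cartesian_product case_prod_unfold)
  have gram: "complex_of_real (\<Sum>p\<in>L \<times> L. ?s p z * ?s p x) =
    (if ssum z x0 = ssum x x0 then opmul L (raise 0) (lower 0) z x else 0)"
  proof -
    have "(\<Sum>C\<in>L. ?s (y, C) z * ?s (y, C) x) = (if ssum z x0 = ssum x x0 then
        of_bool (y \<subseteq> z \<and> dim z = dim y + 1 \<and> idim z = idim y) *
        of_bool (y \<subseteq> x \<and> dim x = dim y + 1 \<and> idim x = idim y) else 0)" for y
    proof -
      have "(\<Sum>C\<in>L. ?s (y, C) z * ?s (y, C) x) = (\<Sum>C\<in>L. if C = ssum x x0 then (if ssum z x0 = ssum x x0 then
        of_bool (y \<subseteq> z \<and> dim z = dim y + 1 \<and> idim z = idim y) *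
        of_bool (y \<subseteq> x \<and> dim x = dim y + 1 \<and> idim x = idim y) else 0) else 0)"
        by (intro sum.cong) auto
      then show ?thesis
        using finite_L zx by (simp add: L_closed)
    qed
    moreover have "complex_of_real (of_bool P) = of_bool P" for P
      by simp
    ultimately show ?thesis
      unfolding pairs by (simp add: opmul_def lower_def)
  qed
  have "M z x = (if z = x then of_nat CARD('a) ^ (dim x0 - idim x) else 0) +
    (of_nat CARD('a) - 1) * (if ssum z x0 = ssum x x0 then opmul L (raise 0) (lower 0) z x else 0)"
  proof (cases "x = z")
    case True
    have "M x x = of_nat CARD('a) ^ (dim x0 - idim x) +
        (of_nat CARD('a) - 1) * opmul L (raise 0) (lower 0) x x"
      unfolding raise0_lower0_diag[OF zx(2)] Mop_diag[OF zx(2)] by simp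
    then show ?thesis
      by (simp only: True refl if_True)
  next
    case False
    let ?V = "dim x = dim z \<and> dim x = dim (x \<inter> z) + 1 \<and> idim z = idim (x \<inter> z) + 0 \<and> idim x = idim (x \<inter> z) + 0"
    let ?W = "idim (x \<inter> z) = idim x \<and> idim z = idim x \<and>
      dim z = dim x \<and> dim (ssum x z) = dim x + 1 \<and> idim (ssum x z) = idim x + 1"
    have of_bool_conj: "(of_bool W :: complex) = (if S then of_bool V else 0)" if "(V \<and> S) = W" for S V W
      using that by auto
    \<comment> \<open>Sharing a hyperplane above both intersections leaves two values for
      \<open>idim (ssum x z)\<close>; equal sums with \<open>x0\<close> select the larger one, the
      \<open>D3\<close> case. This is why the Gram vectors also record
      \<open>x + x0\<close>.\<close>
    have "(?V \<and> ssum z x0 = ssum x x0) = ?W"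
      unfolding ssum_x0_eq_iff'[OF zx] using dim_pair[OF zx(2,1)]
      by (intro iffI conjI; elim conjE; linarith)
    then have "(of_bool ?W :: complex) = (if ssum z x0 = ssum x x0 then of_bool ?V else 0)"
      by (rule of_bool_conj)
    then show ?thesis
      unfolding raise_lower_offdiag[OF zx(2,1) False] Mop_offdiag[OF zx False] using False by (simp only: if_False not_sym simp_thms add_0)
  qed
  then show "M z x = complex_of_real ((if z = x then ?c x else 0) +
      (real CARD('a) - 1) * (\<Sum>p\<in>L \<times> L. ?s p z * ?s p x))"
    unfolding of_real_add of_real_mult gram by simp
qed

subsection \<open>The defining relations\<close>

definition d1 :: "'v set \<Rightarrow> complex" where
  "d1 x = qq TYPE('a) powi ((int (dim Om) - int (dim x0)) - 2 * (int (dim (ssum x x0)) - int (dim x0)))"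

definition d2 :: "'v set \<Rightarrow> complex" where
  "d2 x = qq TYPE('a) powi (int (dim x0) - 2 * int (dim (x \<inter> x0)))"

lemma D1op_eq_diag: "D1op sc Om x0 = diag_op d1"
  by (auto simp: fun_eq_iff D1op_def diag_op_def d1_def)

lemma D2op_eq_diag: "D2op sc x0 = diag_op d2"
  by (auto simp: fun_eq_iff D2op_def diag_op_def d2_def)

lemma d_nonzero: "d1 x \<noteq> 0" "d2 x \<noteq> 0"
  by (simp_all add: d1_def d2_def qq_nonzero)

lemma qq_powi_shift:
  "qq TYPE('a) powi (m + 2) = of_nat CARD('a) * qq TYPE('a) powi m"
  by (subst power_int_add) (simp_all add: qq_nonzero mult.commute flip: qq_sq)

lemma d1_shift:
  assumes "dim (ssum x x0) = dim (ssum y x0) + 1"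
  shows "d1 y = of_nat CARD('a) * d1 x"
  unfolding d1_def qq_powi_shift[symmetric] using assms by (simp add: algebra_simps)

lemma d2_shift:
  assumes "idim x = idim y + 1"
  shows "d2 y = of_nat CARD('a) * d2 x"
  unfolding d2_def qq_powi_shift[symmetric] using assms by (simp add: algebra_simps idim_def)

text \<open>By the dimension formula the exponents of \<open>d1 x\<close> and \<open>d2 x\<close>
  add up to \<open>dim Om - 2 * dim x\<close>. This identifies the diagonal parts of the two
  commutators with \<open>D1 D2\<close> and its inverse, up to \<open>q^D\<close>.\<close>

lemma d1_mult_d2:
  assumes "x \<in> L"
  shows "qq TYPE('a) ^ dim Om * d1 x * d2 x = of_nat CARD('a) ^ (dim Om - dim x)"
    "d1 x * d2 x * of_nat CARD('a) ^ dim x = qq TYPE('a) ^ dim Om"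
proof -
  have le: "dim x \<le> dim Om"
    using assms in_L by (intro dim_mono_L) (auto simp: L_closed)
  have e: "(int (dim Om) - int (dim x0)) - 2 * (int (dim (ssum x x0)) - int (dim x0)) +
      (int (dim x0) - 2 * int (dim (x \<inter> x0))) = int (dim Om) - 2 * int (dim x)"
    using dim_ssum_x0[OF assms] by (simp add: idim_def)
  have d: "d1 x * d2 x = qq TYPE('a) powi (int (dim Om) - 2 * int (dim x))"
    unfolding d1_def d2_def by (subst power_int_add[symmetric]) (simp_all only: e qq_nonzero simp_thms)
  have p: "of_nat CARD('a) ^ m = qq TYPE('a) powi (2 * int m)" for m
    by (simp add: power_int_mult flip: qq_sq)
  have D: "qq TYPE('a) ^ dim Om = qq TYPE('a) powi int (dim Om)"
    by simp
  show "qq TYPE('a) ^ dim Om * d1 x * d2 x = of_nat CARD('a) ^ (dim Om - dim x)"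
    unfolding mult.assoc d p D using le qq_nonzero
    by (subst power_int_add[symmetric]) (simp_all add: of_nat_diff)
  show "d1 x * d2 x * of_nat CARD('a) ^ dim x = qq TYPE('a) ^ dim Om"
    unfolding d p D using qq_nonzero by (subst power_int_add[symmetric]) simp_all
qed

lemma lower_nonzero:
  assumes "lower a y x \<noteq> 0" "y \<in> L" "x \<in> L"
  shows "dim x = dim y + 1" "idim x = idim y + a" "dim (ssum x x0) + a = dim (ssum y x0) + 1"
  using assms dim_ssum_x0[of x] dim_ssum_x0[of y] by (auto simp: lower_def split: if_splits)

lemma D_shift_cancel: "y = of_nat CARD('a) * x \<longleftrightarrow> x = inverse (of_nat CARD('a)) * (y :: complex)"
  using CARD_ge2 by (auto simp: field_simps)

section \<open>Scalar commutation with \<open>D1\<close>, \<open>D2\<close> and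
  \<open>M\<close>\<close>

text \<open>Specialises \<open>qcommute_diag\<close> to the dimension changes along an entry of
  \<open>L1\<close>. For the raising operators below, rows and columns swap roles and the factor
  appears on the other side.\<close>

lemma L1_diag:
  assumes "\<And>y x. y \<in> L \<Longrightarrow> x \<in> L \<Longrightarrow> dim x = dim y + 1 \<Longrightarrow> idim x = idim y \<Longrightarrow>
    dim (ssum x x0) = dim (ssum y x0) + 1 \<Longrightarrow> d x = s * d y"
  shows "qcommute L s L1 (diag_op d)"
proof (rule qcommute_diag[OF finite_L])
  fix y x assume yx: "y \<in> L" "x \<in> L" "L1 y x \<noteq> 0"
  then have "lower 0 y x \<noteq> 0"
    by (simp add: LR_eq)
  from lower_nonzero[OF this yx(1,2)] show "d x = s * d y"
    using assms[OF yx(1,2)] by simp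
qed

lemma L2_diag:
  assumes "\<And>y x. y \<in> L \<Longrightarrow> x \<in> L \<Longrightarrow> dim x = dim y + 1 \<Longrightarrow> idim x = idim y + 1 \<Longrightarrow>
    dim (ssum x x0) = dim (ssum y x0) \<Longrightarrow> d x = s * d y"
  shows "qcommute L s L2 (diag_op d)"
proof (rule qcommute_diag[OF finite_L])
  fix y x assume yx: "y \<in> L" "x \<in> L" "L2 y x \<noteq> 0"
  then have "lower 1 y x \<noteq> 0"
    by (simp add: LR_eq)
  from lower_nonzero[OF this yx(1,2)] show "d x = s * d y"
    using assms[OF yx(1,2)] by simp
qed

lemma R1_diag:
  assumes "\<And>y x. y \<in> L \<Longrightarrow> x \<in> L \<Longrightarrow> dim x = dim y + 1 \<Longrightarrow> idim x = idim y \<Longrightarrow>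
    dim (ssum x x0) = dim (ssum y x0) + 1 \<Longrightarrow> d y = s * d x"
  shows "qcommute L s R1 (diag_op d)"
proof (rule qcommute_diag[OF finite_L])
  fix y x assume yx: "y \<in> L" "x \<in> L" "R1 y x \<noteq> 0"
  then have "lower 0 x y \<noteq> 0"
    by (simp add: LR_eq)
  from lower_nonzero[OF this yx(2,1)] show "d x = s * d y"
    using assms[OF yx(2,1)] by simp
qed

lemma R2_diag:
  assumes "\<And>y x. y \<in> L \<Longrightarrow> x \<in> L \<Longrightarrow> dim x = dim y + 1 \<Longrightarrow> idim x = idim y + 1 \<Longrightarrow>
    dim (ssum x x0) = dim (ssum y x0) \<Longrightarrow> d y = s * d x"
  shows "qcommute L s R2 (diag_op d)"
proof (rule qcommute_diag[OF finite_L])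
  fix y x assume yx: "y \<in> L" "x \<in> L" "R2 y x \<noteq> 0"
  then have "lower 1 x y \<noteq> 0"
    by (simp add: LR_eq)
  from lower_nonzero[OF this yx(2,1)] show "d x = s * d y"
    using assms[OF yx(2,1)] by simp
qed

lemma qcommute_d1:
  "qcommute L (inverse (of_nat CARD('a))) L1 (diag_op d1)"
  "qcommute L 1 L2 (diag_op d1)"
  "qcommute L (of_nat CARD('a)) R1 (diag_op d1)"
  "qcommute L 1 R2 (diag_op d1)"
proof -
  show "qcommute L (inverse (of_nat CARD('a))) L1 (diag_op d1)"
    by (rule L1_diag) (simp only: D_shift_cancel[symmetric] d1_shift)
  show "qcommute L (of_nat CARD('a)) R1 (diag_op d1)"
    by (rule R1_diag) (simp only: d1_shift)
  show "qcommute L 1 L2 (diag_op d1)"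
    by (rule L2_diag) (simp add: d1_def)
  show "qcommute L 1 R2 (diag_op d1)"
    by (rule R2_diag) (simp add: d1_def)
qed

lemma qcommute_d2:
  "qcommute L 1 L1 (diag_op d2)"
  "qcommute L (inverse (of_nat CARD('a))) L2 (diag_op d2)"
  "qcommute L 1 R1 (diag_op d2)"
  "qcommute L (of_nat CARD('a)) R2 (diag_op d2)"
proof -
  show "qcommute L 1 L1 (diag_op d2)"
    by (rule L1_diag) (simp add: d2_def idim_def)
  show "qcommute L 1 R1 (diag_op d2)"
    by (rule R1_diag) (simp add: d2_def idim_def)
  show "qcommute L (inverse (of_nat CARD('a))) L2 (diag_op d2)"
    by (rule L2_diag) (simp only: D_shift_cancel[symmetric] d2_shift)
  show "qcommute L (of_nat CARD('a)) R2 (diag_op d2)"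
    by (rule R2_diag) (simp only: d2_shift)
qed

text \<open>The last four products are rewritten as transposes of products already computed, so the
  relations with \<open>R1\<close> on the left or with \<open>R2 R1\<close> need no new
  counting.\<close>

lemma opmul_LR:
  assumes "z \<in> L" "x \<in> L"
  shows "opmul L L1 L2 z x = opmul L (lower 0) (lower 1) z x" "opmul L L2 L1 z x = opmul L (lower 1) (lower 0) z x"
    "opmul L L1 R1 z x = opmul L (lower 0) (raise 0) z x" "opmul L R1 L1 z x = opmul L (raise 0) (lower 0) z x"
    "opmul L L2 R2 z x = opmul L (lower 1) (raise 1) z x" "opmul L R2 L2 z x = opmul L (raise 1) (lower 1) z x"
    "opmul L L1 R2 z x = opmul L (lower 0) (raise 1) z x" "opmul L R2 L1 z x = opmul L (raise 1) (lower 0) z x"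
    "opmul L R1 R2 z x = opmul L (lower 1) (lower 0) x z" "opmul L R2 R1 z x = opmul L (lower 0) (lower 1) x z"
    "opmul L R1 L2 z x = opmul L (raise 1) (lower 0) x z" "opmul L L2 R1 z x = opmul L (lower 0) (raise 1) x z"
  unfolding opmul_def using assms by (intro sum.cong refl; simp only: LR_eq mult.commute)+

lemma qcommute_LR:
  "qcommute L (of_nat CARD('a)) L1 L2" "qcommute L 1 L1 R2"
  "qcommute L 1 R1 L2" "qcommute L (of_nat CARD('a)) R2 R1"
  unfolding qcommute_def opeq_def opsmult_def
  by (intro ballI; simp only: opmul_LR lower0_lower1 lower0_raise1 mult_1_left)+

lemma M_eq_comm_L1_R1: "opeq L M (opadd (diag_op (\<lambda>x. of_nat CARD('a) ^ (dim Om - dim x)))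
    (opsmult (1 - of_nat CARD('a)) (comm L L1 R1)))" (is "opeq L M (opadd (diag_op ?p) (opsmult ?k (comm L ?A ?B)))")
proof -
  have "m = p + (1 - k) * c" if "(k - 1) * c = p - m" for c k m p :: complex
    using that by algebra
  note solve = this
  show ?thesis
    unfolding opeq_def
  proof (intro ballI)
    fix z x assume zx: "z \<in> L" "x \<in> L"
    from solve[OF comm_lower0_raise0[OF zx]] show "M z x = opadd (diag_op ?p) (opsmult ?k (comm L ?A ?B)) z x"
      by (simp only: opadd_def opsmult_def comm_def diag_op_def opmul_LR[OF zx])
  qed
qed

lemma M_eq_comm_L2_R2: "opeq L M (opadd (diag_op (\<lambda>x. of_nat CARD('a) ^ dim x))
    (opsmult (of_nat CARD('a) - 1) (comm L L2 R2)))" (is "opeq L M (opadd (diag_op ?p) (opsmult ?k (comm L ?A ?B)))")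
proof -
  have "m = p + (k - 1) * c" if "(k - 1) * c = m - p" for c k m p :: complex
    using that by algebra
  note solve = this
  show ?thesis
    unfolding opeq_def
  proof (intro ballI)
    fix z x assume zx: "z \<in> L" "x \<in> L"
    from solve[OF comm_lower1_raise1[OF zx]] show "M z x = opadd (diag_op ?p) (opsmult ?k (comm L ?A ?B)) z x"
      by (simp only: opadd_def opsmult_def comm_def diag_op_def opmul_LR[OF zx])
  qed
qed

text \<open>\<open>M\<close> is block diagonal for the partition of \<open>L\<close> by the pair
  \<open>(x + x0, x \<inter> x0)\<close>, so weights constant on blocks commute with it.\<close>

lemma qcommute_M_diag:
  assumes "\<And>y x. y \<in> L \<Longrightarrow> x \<in> L \<Longrightarrow> ssum y x0 = ssum x x0 \<Longrightarrow> y \<inter> x0 = x \<inter> x0 \<Longrightarrow> d x = d y"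
  shows "qcommute L 1 M (diag_op d)"
proof (rule qcommute_diag[OF finite_L])
  fix y x assume yx: "y \<in> L" "x \<in> L" "M y x \<noteq> 0"
  have "ssum y x0 = ssum x x0 \<and> y \<inter> x0 = x \<inter> x0"
  proof (rule ccontr)
    assume neq: "\<not> ?thesis"
    then have "D3op sc x0 x1 y x = 0"
      unfolding D3op_def by (intro if_not_P) blast
    moreover have "D4op x0 y x = 0"
      unfolding D4op_def using neq by (intro if_not_P) blast
    ultimately show False
      using yx(3) by (simp add: Mop_def opadd_def opsmult_def)
  qed
  then show "d x = 1 * d y"
    using assms[OF yx(1,2)] by simp
qed

text \<open>\<open>L1\<close> and \<open>R1\<close> are tested against the expression of
  \<open>M\<close> through \<open>[L2, R2]\<close>, and \<open>L2\<close> and \<open>R2\<close>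
  against the one through \<open>[L1, R1]\<close>. In each case the diagonal part changes by the
  same scalar as the commutator.\<close>

lemma qcommute_M:
  "qcommute L (of_nat CARD('a)) L1 M" "qcommute L (inverse (of_nat CARD('a))) R1 M"
  "qcommute L (inverse (of_nat CARD('a))) L2 M" "qcommute L (of_nat CARD('a)) R2 M"
  "qcommute L 1 (diag_op d1) M" "qcommute L 1 (diag_op d2) M"
proof -
  define k :: complex where "k = of_nat CARD('a)"
  have k: "k \<noteq> 0"
    by (simp add: k_def)
  have pow: "k ^ (dim Om - dim y) = k * k ^ (dim Om - dim x)" if "x \<in> L" "dim x = dim y + 1" for x y
  proof -
    have "dim x \<le> dim Om"
      using that(1) in_L by (intro dim_mono_L) (auto simp: L_closed)
    then have "dim Om - dim y = Suc (dim Om - dim x)"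
      using that by linarith
    then show ?thesis by simp
  qed
  note inv = qcommute_flip[where s = k and t = "inverse k"] qcommute_flip[where s = 1 and t = 1]
  have qc: "qcommute L k L1 L2" "qcommute L 1 L1 R2" "qcommute L 1 R1 L2" "qcommute L k R2 R1"
    using qcommute_LR by (simp_all add: k_def)
  have qc': "qcommute L (inverse k) L2 L1" "qcommute L 1 R2 L1" "qcommute L 1 L2 R1" "qcommute L (inverse k) R1 R2"
    using qc k by (auto intro: inv)
  have "qcommute L k L1 (diag_op (\<lambda>x. k ^ dim x))"
    by (rule L1_diag) simp
  then have "qcommute L k L1 (opadd (diag_op (\<lambda>x. k ^ dim x)) (opsmult (k - 1) (comm L L2 R2)))"
    using qcommute_comm[OF finite_L qc(1,2)] by (intro qcommute_opadd qcommute_opsmult) simp_all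
  then show "qcommute L (of_nat CARD('a)) L1 M"
    unfolding k_def by (rule qcommute_opeq_right[OF M_eq_comm_L2_R2])
  have "qcommute L (inverse k) R1 (diag_op (\<lambda>x. k ^ dim x))"
    by (rule R1_diag) (simp add: k)
  then have "qcommute L (inverse k) R1 (opadd (diag_op (\<lambda>x. k ^ dim x)) (opsmult (k - 1) (comm L L2 R2)))"
    using qcommute_comm[OF finite_L qc(3) qc'(4)] by (intro qcommute_opadd qcommute_opsmult) simp_all
  then show "qcommute L (inverse (of_nat CARD('a))) R1 M"
    unfolding k_def by (rule qcommute_opeq_right[OF M_eq_comm_L2_R2])
  have "qcommute L (inverse k) L2 (diag_op (\<lambda>x. k ^ (dim Om - dim x)))"
    by (rule L2_diag) (simp add: pow k)
  then have "qcommute L (inverse k) L2 (opadd (diag_op (\<lambda>x. k ^ (dim Om - dim x))) (opsmult (1 - k) (comm L L1 R1)))"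
    using qcommute_comm[OF finite_L qc'(1,3)] by (intro qcommute_opadd qcommute_opsmult) simp_all
  then show "qcommute L (inverse (of_nat CARD('a))) L2 M"
    unfolding k_def by (rule qcommute_opeq_right[OF M_eq_comm_L1_R1])
  have "qcommute L k R2 (diag_op (\<lambda>x. k ^ (dim Om - dim x)))"
    by (rule R2_diag) (simp add: pow)
  then have "qcommute L k R2 (opadd (diag_op (\<lambda>x. k ^ (dim Om - dim x))) (opsmult (1 - k) (comm L L1 R1)))"
    using qcommute_comm[OF finite_L qc'(2) qc(4)] by (intro qcommute_opadd qcommute_opsmult) simp_all
  then show "qcommute L (of_nat CARD('a)) R2 M"
    unfolding k_def by (rule qcommute_opeq_right[OF M_eq_comm_L1_R1])
  have "qcommute L 1 M (diag_op d1)" "qcommute L 1 M (diag_op d2)"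
    by (rule qcommute_M_diag; simp add: d1_def d2_def)+
  then show "qcommute L 1 (diag_op d1) M" "qcommute L 1 (diag_op d2) M"
    by (auto intro: inv)
qed

text \<open>The scalings stay abstract: rescaling preserves the homogeneous relations, and the two
  inhomogeneous ones see only \<open>c1 * c2\<close> and \<open>c3\<close>. The conditions force
  \<open>c3\<close> to be \<open>q^(-D)\<close>.\<close>

lemma Wq_relations_hold:
  fixes E1 E2 F1 F2 I Ii c1 c2 c3 c3'
  defines "q \<equiv> qq TYPE('a)" and "K1 \<equiv> diag_op d1" and "K2 \<equiv> diag_op d2"
  defines "E1 \<equiv> opsmult c1 L1" and "E2 \<equiv> opsmult c1 (opmul L K1 L2)"
    and "F1 \<equiv> opsmult c2 (opmul L R1 (opinv L K2))" and "F2 \<equiv> opsmult c2 R2"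
    and "I \<equiv> opsmult c3 (opmul L (opmul L K1 (opinv L K2)) M)"
    and "Ii \<equiv> opsmult c3' (opmul L (opmul L (opinv L K1) K2) (opinv L M))"
  assumes c12: "c1 * c2 = q * c3" and c3: "c3 * q ^ dim Om = 1" and c3': "c3 * c3' = 1"
  shows "Wq_relations q L E1 E2 F1 F2 K1 (opinv L K1) K2 (opinv L K2) I Ii"
proof -
  define k where "k = q\<^sup>2"
  define K1i K2i where "K1i = opinv L K1" and "K2i = opinv L K2"
  have kQ: "of_nat CARD('a) = k"
    by (simp add: k_def q_def qq_sq)
  have q: "q \<noteq> 0" and k: "k \<noteq> 0"
    by (simp_all add: k_def q_def qq_nonzero)
  have k1: "k \<noteq> 1"
    unfolding kQ[symmetric] using CARD_ge2 by simp
  note fin = finite_L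
  have pK1: "inverse_pair L K1 K1i" and pK2: "inverse_pair L K2 K2i"
    unfolding K1_def K2_def K1i_def K2i_def
    using fin d_nonzero by (blast intro: inverse_pair_opinv inverse_pair_diag)+
  have pM: "inverse_pair L M (opinv L M)"
    using opinvertible_M by (auto simp: opinvertible_def inverse_pair_def[symmetric] intro: inverse_pair_opinv)

  have flip1: "qcommute L 1 B A" if "qcommute L 1 A B" for A B
    using that by (rule qcommute_flip) simp
  have flipk: "qcommute L (inverse k) B A" if "qcommute L k A B" for A B
    using that by (rule qcommute_flip) (simp add: k)
  have flipik: "qcommute L k B A" if "qcommute L (inverse k) A B" for A B
    using that by (rule qcommute_flip) (simp add: k)
  have mul1: "qcommute L 1 A (opmul L B C)" if "qcommute L s A B" "qcommute L t A C" "s * t = 1" for A B C s t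
    using qcommute_opmul[OF fin that(1,2)] that(3) by simp

  have K1: "qcommute L (inverse k) L1 K1" "qcommute L 1 L2 K1" "qcommute L k R1 K1" "qcommute L 1 R2 K1"
    using qcommute_d1 by (simp_all add: K1_def kQ)
  have K2: "qcommute L 1 L1 K2" "qcommute L (inverse k) L2 K2" "qcommute L 1 R1 K2" "qcommute L k R2 K2"
    using qcommute_d2 by (simp_all add: K2_def kQ)
  have K2i: "qcommute L 1 L1 K2i" "qcommute L k L2 K2i" "qcommute L 1 R1 K2i" "qcommute L (inverse k) R2 K2i"
    using K2[THEN qcommute_inverse[OF fin pK2]] k by simp_all
  have K1K2: "qcommute L 1 K1 K2"
    unfolding K1_def K2_def by (rule qcommute_diag_diag[OF fin])
  have K1K2i: "qcommute L 1 K1 K2i"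
    using qcommute_inverse[OF fin pK2 K1K2] by simp
  have K2K2i: "qcommute L 1 K2 K2i"
    using qcommute_inverse[OF fin pK2 qcommute_refl] by simp
  have LR: "qcommute L k L1 L2" "qcommute L 1 L1 R2" "qcommute L 1 R1 L2" "qcommute L k R2 R1"
    using qcommute_LR by (simp_all add: kQ)
  have Mc: "qcommute L k L1 M" "qcommute L (inverse k) R1 M" "qcommute L (inverse k) L2 M" "qcommute L k R2 M"
    "qcommute L 1 K1 M" "qcommute L 1 K2 M"
    using qcommute_M by (simp_all add: kQ K1_def K2_def)

  have pI: "inverse_pair L I Ii"
  proof -
    have pair: "inverse_pair L (opmul L K1 K2i) (opmul L K1i K2)"
      using fin pK1 inverse_pair_sym[OF pK2] K1K2i by (rule inverse_pair_opmul)
    have "qcommute L 1 M (opmul L K1 K2i)"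
      using mul1[OF flip1[OF Mc(5)] qcommute_inverse[OF fin pK2 flip1[OF Mc(6)]]] by simp
    then have "inverse_pair L (opmul L (opmul L K1 K2i) M) (opmul L (opmul L K1i K2) (opinv L M))"
      by (rule inverse_pair_opmul[OF fin pair pM flip1])
    then show ?thesis
      unfolding I_def Ii_def K1i_def K2i_def by (rule inverse_pair_opsmult[OF _ c3'])
  qed
  \<comment> \<open>\<open>s\<close>, \<open>t\<close>, \<open>u\<close> are the scalars picked up
    on moving \<open>A\<close> past the three factors of \<open>I\<close>.\<close>
  have cI: "qcommute L 1 I A" if "qcommute L s A K1" "qcommute L t A K2i" "qcommute L u A M" "s * t * u = 1" for A s t u
    unfolding I_def K2i_def[symmetric]
    by (rule flip1[OF qcommute_opsmult[OF mul1[OF qcommute_opmul[OF fin that(1,2)] that(3,4)]]])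
  have IL1: "qcommute L 1 I L1" and IL2: "qcommute L 1 I L2" and IR1: "qcommute L 1 I R1" and IR2: "qcommute L 1 I R2"
    using cI[OF K1(1) K2i(1) Mc(1)] cI[OF K1(2) K2i(2) Mc(3)] cI[OF K1(3) K2i(3) Mc(2)] cI[OF K1(4) K2i(4) Mc(4)] k
    by simp_all
  have IK1: "qcommute L 1 I K1" and IK2: "qcommute L 1 I K2"
    using cI[OF qcommute_refl K1K2i Mc(5)] cI[OF flip1[OF K1K2] K2K2i Mc(6)] by simp_all
  have IK1i: "qcommute L 1 I K1i" and IK2i: "qcommute L 1 I K2i" and III: "qcommute L 1 I Ii"
    using qcommute_inverse[OF fin pK1 IK1] qcommute_inverse[OF fin pK2 IK2] qcommute_inverse[OF fin pI qcommute_refl]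
    by simp_all
  have central: "qcommute L 1 I X" if "X \<in> {E1, E2, F1, F2, K1, K1i, K2, K2i, I, Ii}" for X
  proof -
    have "qcommute L 1 I E1" "qcommute L 1 I E2" "qcommute L 1 I F1" "qcommute L 1 I F2"
      unfolding E1_def E2_def F1_def F2_def K2i_def[symmetric]
      using IL1 mul1[OF IK1 IL2] mul1[OF IR1 IK2i] IR2 by (simp_all add: qcommute_opsmult)
    then show ?thesis
      using that IK1 IK2 IK1i IK2i III by (auto simp only: insert_iff empty_iff qcommute_refl)
  qed
  have central': "qcommute L 1 Ii X" if "X \<in> {E1, E2, F1, F2, K1, K1i, K2, K2i, I, Ii}" for X
    by (rule flip1[OF qcommute_inverse[OF fin pI flip1[OF central[OF that]]]]) simp

  have K1E2: "qcommute L 1 K1 E2"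
    unfolding E2_def using mul1[OF qcommute_refl flip1[OF K1(2)]] by (simp add: qcommute_opsmult)
  have K1F2: "qcommute L 1 K1 F2" and K2E1: "qcommute L 1 K2 E1"
    unfolding F2_def E1_def using flip1[OF K1(4)] flip1[OF K2(1)] by (simp_all add: qcommute_opsmult)
  have K2F1: "qcommute L 1 K2 F1"
    unfolding F1_def K2i_def[symmetric] using mul1[OF flip1[OF K2(3)] K2K2i] by (simp add: qcommute_opsmult)
  have E1K1: "qcommute L (inverse k) E1 K1"
    unfolding E1_def by (rule qcommute_opsmult_left[OF K1(1)])
  have K1F1: "qcommute L (inverse k) K1 F1"
    unfolding F1_def K2i_def[symmetric]
    using qcommute_opmul[OF fin flipk[OF K1(3)] K1K2i] by (simp add: qcommute_opsmult)
  have E2K2: "qcommute L (inverse k) E2 K2"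
    unfolding E2_def using qcommute_opmul_left[OF fin K1K2 K2(2)] k by (simp add: qcommute_opsmult_left)
  have K2F2: "qcommute L (inverse k) K2 F2"
    unfolding F2_def by (rule qcommute_opsmult[OF flipk[OF K2(4)]])
  \<comment> \<open>The factor \<open>D1\<close> inside \<open>E2\<close> is there for this
    relation: its scalar against \<open>L1\<close> cancels the one from
    \<open>L1 L2\<close>.\<close>
  have E1E2: "qcommute L 1 E1 E2"
    unfolding E1_def E2_def using mul1[OF K1(1) LR(1)] k by (simp add: qcommute_opsmult_left qcommute_opsmult)
  have E1F2: "qcommute L 1 E1 F2"
    unfolding E1_def F2_def by (intro qcommute_opsmult_left qcommute_opsmult LR)
  have F1E2: "qcommute L 1 F1 E2"
  proof -
    \<comment> \<open>Two scalars arise, from \<open>R1\<close> past \<open>K1\<close> and from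
      \<open>K2i\<close> past \<open>L2\<close>; they are inverse to each other.\<close>
    have "qcommute L k (opmul L R1 K2i) K1"
      using qcommute_opmul_left[OF fin K1(3) flip1[OF K1K2i]] k by simp
    moreover have "qcommute L (inverse k) (opmul L R1 K2i) L2"
      using qcommute_opmul_left[OF fin LR(3) flipk[OF K2i(2)]] k by simp
    ultimately show ?thesis
      unfolding F1_def E2_def K2i_def[symmetric]
      by (intro qcommute_opsmult_left qcommute_opsmult mul1[OF _ _ right_inverse[OF k]])
  qed
  \<comment> \<open>Here the inverse of \<open>D2\<close> inside \<open>F1\<close> compensates the
    scalar between \<open>R1\<close> and \<open>R2\<close>.\<close>
  have F1F2: "qcommute L 1 F1 F2"
    unfolding F1_def F2_def K2i_def[symmetric]
    using qcommute_opmul_left[OF fin flipk[OF LR(4)] flipik[OF K2i(4)]] k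
    by (simp add: qcommute_opsmult_left qcommute_opsmult)

  have eK1i: "K1i y x = (if y = x then inverse (d1 x) else 0)" and eK2i: "K2i y x = (if y = x then inverse (d2 x) else 0)"
    if "y \<in> L" "x \<in> L" for y x
    using that opinv_diag[OF fin d_nonzero(1)] opinv_diag[OF fin d_nonzero(2)]
    by (auto simp: opeq_def K1i_def K2i_def K1_def K2_def diag_op_def)
  have K1i_right: "opmul L A K1i y x = A y x * inverse (d1 x)" and K2i_right: "opmul L A K2i y x = A y x * inverse (d2 x)"
    if "x \<in> L" for A y x
    using that opmul_diag_right[OF fin that, of A "\<lambda>x. inverse (d1 x)" y] opmul_diag_right[OF fin that, of A "\<lambda>x. inverse (d2 x)" y]
    by (simp_all add: opmul_def eK1i eK2i diag_op_def)
  \<comment> \<open>\<open>M\<close> is moved to the left so that both diagonal factors become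
    weights of the column \<open>x\<close>.\<close>
  have I_entry: "I y x = c3 * (d1 x / d2 x * M y x)" if "y \<in> L" "x \<in> L" for y x
  proof -
    have "qcommute L 1 (opmul L K1 K2i) M"
      by (rule flip1[OF mul1[OF flip1[OF Mc(5)] qcommute_inverse[OF fin pK2 flip1[OF Mc(6)]]]]) simp_all
    then have "I y x = c3 * opmul L M (opmul L K1 K2i) y x"
      using that by (simp add: I_def K2i_def[symmetric] opsmult_def qcommute_def opeq_def)
    also have "opmul L M (opmul L K1 K2i) = opmul L (opmul L M K1) K2i"
      by (simp add: opmul_assoc[OF fin])
    finally show ?thesis
      using that by (simp add: K2i_right K1_def opmul_diag_right[OF fin] field_simps)
  qed
  have divk: "u = v / (k - 1)" if "(k - 1) * u = v" for u v
    using that k1 by (subst nonzero_eq_divide_eq) (auto simp: mult.commute)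
  \<comment> \<open>The commutator lemmas divide by \<open>q^2 - 1\<close>, the defining relations
    by \<open>q - 1/q\<close>; the leftover q is the one in \<open>c1 * c2 = q * c3\<close>.\<close>
  have "k - 1 = q * (q - inverse q)"
    using q by (simp add: k_def right_diff_distrib power2_eq_square)
  then have scale: "q * c3 * r * (v / (k - 1)) = c3 * r * v / (q - inverse q)" for r v
    using q by simp

  have EF1: "opeq L (comm L E1 F1) (\<lambda>y x. (K1 y x - opmul L I K1i y x) / (q - inverse q))"
    unfolding opeq_def
  proof (intro ballI)
    fix y x assume yx: "y \<in> L" "x \<in> L"
    have "opmul L E1 F1 y x = c1 * c2 * (opmul L L1 R1 y x / d2 x)"
      unfolding E1_def F1_def K2i_def[symmetric] opmul_opsmult_left opmul_opsmult_right opsmult_opsmult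
        opmul_assoc[OF fin, symmetric] using yx by (simp add: opsmult_def K2i_right field_simps)
    moreover have "opmul L F1 E1 y x = c1 * c2 * (opmul L R1 L1 y x / d2 x)"
    proof -
      have "opeq L (opmul L R1 (opmul L K2i L1)) (opmul L R1 (opmul L L1 K2i))"
        using flip1[OF K2i(1)] by (intro opeq_opmul[OF opeq_refl]) (simp add: qcommute_def)
      then have "opmul L R1 (opmul L K2i L1) y x = opmul L (opmul L R1 L1) K2i y x"
        using yx by (simp add: opeq_def opmul_assoc[OF fin])
      then have "opmul L R1 (opmul L K2i L1) y x = opmul L R1 L1 y x * inverse (d2 x)"
        using yx by (simp only: K2i_right)
      then show ?thesis
        unfolding E1_def F1_def K2i_def[symmetric] opmul_opsmult_left opmul_opsmult_right opsmult_opsmult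
          opmul_assoc[OF fin] by (simp add: opsmult_def field_simps)
    qed
    ultimately have "comm L E1 F1 y x = c1 * c2 * inverse (d2 x) * (opmul L L1 R1 y x - opmul L R1 L1 y x)"
      by (simp add: comm_def divide_inverse right_diff_distrib mult_ac)
    also have "\<dots> = c1 * c2 * inverse (d2 x) * (((if y = x then k ^ (dim Om - dim x) else 0) - M y x) / (k - 1))"
      using divk[OF comm_lower0_raise0[OF yx, unfolded kQ]] by (simp only: opmul_LR[OF yx])
    also have "\<dots> = c3 * inverse (d2 x) * ((if y = x then k ^ (dim Om - dim x) else 0) - M y x) / (q - inverse q)"
      unfolding c12 by (rule scale)
    \<comment> \<open>In operators: \<open>c3\<close> and the inverse of \<open>D2\<close> reduce
      the diagonal part \<open>q^D D1 D2\<close> to \<open>K1\<close>, and \<open>I K1i\<close> is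
      \<open>c3\<close> times \<open>M\<close> with column weight \<open>1 / d2\<close>.\<close>
    also have "c3 * inverse (d2 x) * ((if y = x then k ^ (dim Om - dim x) else 0) - M y x) = K1 y x - opmul L I K1i y x"
    proof -
      have "c3 * inverse (d2 x) * k ^ (dim Om - dim x) = d1 x"
        unfolding kQ[symmetric] d1_mult_d2(1)[OF yx(2), symmetric] q_def[symmetric]
        using c3 d_nonzero(2)[of x] by (simp add: field_simps)
      moreover have "opmul L I K1i y x = c3 * inverse (d2 x) * M y x"
        using yx d_nonzero(1)[of x] by (simp add: K1i_right I_entry field_simps)
      ultimately show ?thesis
        by (simp add: K1_def diag_op_def right_diff_distrib)
    qed
    finally show "comm L E1 F1 y x = (K1 y x - opmul L I K1i y x) / (q - inverse q)" .
  qed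

  have EF2: "opeq L (comm L E2 F2) (\<lambda>y x. (opmul L I K2 y x - K2i y x) / (q - inverse q))"
    unfolding opeq_def
  proof (intro ballI)
    fix y x assume yx: "y \<in> L" "x \<in> L"
    have "opmul L E2 F2 y x = c1 * c2 * (d1 y * opmul L L2 R2 y x)"
      unfolding E2_def F2_def opmul_opsmult_left opmul_opsmult_right opsmult_opsmult opmul_assoc[OF fin]
      using yx by (simp add: opsmult_def K1_def opmul_diag_left[OF fin])
    moreover have "opmul L F2 E2 y x = c1 * c2 * (d1 y * opmul L R2 L2 y x)"
    proof -
      have "opeq L (opmul L (opmul L R2 K1) L2) (opmul L (opmul L K1 R2) L2)"
        using K1(4) by (intro opeq_opmul[OF _ opeq_refl]) (simp add: qcommute_def)
      then have "opmul L R2 (opmul L K1 L2) y x = opmul L K1 (opmul L R2 L2) y x"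
        using yx by (simp add: opeq_def opmul_assoc[OF fin])
      then show ?thesis
        unfolding E2_def F2_def opmul_opsmult_left opmul_opsmult_right opsmult_opsmult
        using yx by (simp add: opsmult_def K1_def opmul_diag_left[OF fin])
    qed
    ultimately have "comm L E2 F2 y x = c1 * c2 * d1 y * (opmul L L2 R2 y x - opmul L R2 L2 y x)"
      by (simp add: comm_def algebra_simps)
    also have "\<dots> = c1 * c2 * d1 y * ((M y x - (if y = x then k ^ dim x else 0)) / (k - 1))"
      using divk[OF comm_lower1_raise1[OF yx, unfolded kQ]] by (simp only: opmul_LR[OF yx])
    also have "\<dots> = c3 * d1 y * (M y x - (if y = x then k ^ dim x else 0)) / (q - inverse q)"
      unfolding c12 by (rule scale)
    \<comment> \<open>In operators: \<open>c3 D1\<close> times the diagonal part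
      \<open>q^D (D1 D2)^(-1)\<close> is \<open>K2i\<close>, and \<open>I K2\<close> is
      \<open>c3 D1 M\<close> because the two powers of \<open>D2\<close> cancel.\<close>
    also have "c3 * d1 y * (M y x - (if y = x then k ^ dim x else 0)) = opmul L I K2 y x - K2i y x"
    proof -
      have "c3 * d1 x * k ^ dim x = inverse (d2 x)"
      proof -
        have "d2 x * (c3 * d1 x * k ^ dim x) = 1"
          using c3 d1_mult_d2(2)[OF yx(2)] unfolding kQ q_def[symmetric] by (simp add: mult_ac)
        then show ?thesis
          by (rule inverse_unique[symmetric])
      qed
      moreover have "opmul L I K2 y x = c3 * d1 y * M y x"
      proof -
        have "d1 y * M y x = M y x * d1 x"
          using flip1[OF Mc(5)] yx unfolding qcommute_def opeq_def K1_def opsmult_1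
          by (simp add: opmul_diag_left[OF fin] opmul_diag_right[OF fin]) metis
        then show ?thesis
          using yx d_nonzero(2)[of x] by (auto simp: K2_def opmul_diag_right[OF fin] I_entry)
      qed
      ultimately show ?thesis
        using yx by (auto simp: eK2i right_diff_distrib)
    qed
    finally show "comm L E2 F2 y x = (opmul L I K2 y x - K2i y x) / (q - inverse q)" .
  qed

  have "\<forall>X\<in>{E1, E2, F1, F2, K1, K1i, K2, K2i, I, Ii}. qcommute L 1 I X \<and> qcommute L 1 Ii X"
    using central central' by blast
  then show ?thesis
    unfolding Wq_relations_def comm_zero_iff_qcommute qcomm_zero_iff_qcommute[OF q] k_def[symmetric]
      K1i_def[symmetric] K2i_def[symmetric]
    using pI pK1 pK2 K1E2 K1F2 K1K2 K2E1 K2F1 E1K1 K1F1 E2K2 K2F2 E1E2 E1F2 F1E2 F1F2 EF1 EF2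
    unfolding inverse_pair_def by (intro conjI) simp_all
qed

end

text \<open>The action of every generator is prescribed, so uniqueness of the module structure is
  automatic and its existence is exactly \<open>Wq_relations\<close>.\<close>

theorem mainTheorem17:
  fixes sc :: "'a::{field,finite} \<Rightarrow> 'v::ab_group_add \<Rightarrow> 'v"
    and Om x0 x1 :: "'v set" and D :: nat
  assumes vs: "vector_space sc"
    and Om_sub: "module.subspace sc Om"
    and Om_fin: "\<exists>B. finite B \<and> B \<subseteq> Om \<and> module.span sc B = Om"
    and Om_dim: "vector_space.dim sc Om = D"
    and x0: "x0 \<in> subspaces sc Om" and x1: "x1 \<in> subspaces sc Om"
    and dsum: "ssum x0 x1 = Om" "x0 \<inter> x1 = {0}"
  shows
    "let L = subspaces sc Om; q = qq TYPE('a); d0 = int (vector_space.dim sc x0);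
         M = Mop sc x0 x1;
         D1 = D1op sc Om x0; D2 = D2op sc x0;
         E1 = opsmult (q powi (d0 - int D)) (L1op sc x0);
         E2 = opsmult (q powi (d0 - int D)) (opmul L D1 (L2op sc x0));
         F1 = opsmult (q powi (1 - d0)) (opmul L (R1op sc x0) (opinv L D2));
         F2 = opsmult (q powi (1 - d0)) (R2op sc x0);
         I = opsmult (q powi (- int D)) (opmul L (opmul L D1 (opinv L D2)) M);
         Ii = opsmult (q powi (int D)) (opmul L (opmul L (opinv L D1) D2) (opinv L M))
     in opinvertible L M \<and>
        Wq_relations q L E1 E2 F1 F2 D1 (opinv L D1) D2 (opinv L D2) I Ii"
proof -
  interpret vector_space sc
    by (rule vs)
  interpret finite_field_space sc ..
  have "finite Om"
    using Om_fin finite_span by metis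
  then interpret split_space sc Om x0 x1
    using Om_sub x0 x1 dsum by unfold_locales (auto simp: subspaces_def)
  let ?q = "qq TYPE('a)"
  \<comment> \<open>The exponents \<open>dim x0 - D\<close> and \<open>1 - dim x0\<close> add up to
    \<open>1 - D\<close>, so \<open>dim x0\<close> drops out.\<close>
  have "?q powi (int (dim x0) - int D) * ?q powi (1 - int (dim x0)) = ?q * ?q powi (- int D)"
    using qq_nonzero by (simp flip: power_int_add power_int_add_1')
  moreover have "?q powi (- int D) * ?q ^ dim Om = 1" "?q powi (- int D) * ?q powi (int D) = 1"
    using qq_nonzero Om_dim by (simp_all add: power_int_minus)
  ultimately have "Wq_relations ?q L (opsmult (?q powi (int (dim x0) - int D)) L1)
      (opsmult (?q powi (int (dim x0) - int D)) (opmul L (diag_op d1) L2))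
      (opsmult (?q powi (1 - int (dim x0))) (opmul L R1 (opinv L (diag_op d2))))
      (opsmult (?q powi (1 - int (dim x0))) R2)
      (diag_op d1) (opinv L (diag_op d1)) (diag_op d2) (opinv L (diag_op d2))
      (opsmult (?q powi (- int D)) (opmul L (opmul L (diag_op d1) (opinv L (diag_op d2))) M))
      (opsmult (?q powi (int D)) (opmul L (opmul L (opinv L (diag_op d1)) (diag_op d2)) (opinv L M)))"
    by (rule Wq_relations_hold)
  then show ?thesis
    unfolding Let_def D1op_eq_diag D2op_eq_diag using opinvertible_M by (rule conjI[rotated])
qed

end
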